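(* For each $a>0$, let $\{Y^{(a)}_n:n\ge 1\}$ be a sequence of i.i.d. real random variables, let $S^{(a)}_0=0$ and $S^{(a)}_n=\sum_{k=1}^n Y^{(a)}_k$ for $n\ge1$, and let $\{X^{(a)}_t:t\ge 0\}$ be a real-valued Lévy process. Assume that for each $a>0$, $Y^{(a)}_1$ and $X^{(a)}_1$ have the same distribution and $\mu^{(a)}:=\mathbb{E}Y^{(a)}_1<0$, and that $\mu^{(a)}\uparrow 0$ as $a\downarrow 0$. Let $\Delta:(0,\infty)\to(0,\infty)$ be a (normalizing) function such that $\Delta(a)X^{(a)}_1\to 0$ almost surely as $a\downarrow 0$. Then, for a random variable $\mathscr{R}$, $$\Delta(a)\max_{n\ge 0} S^{(a)}_n\xrightarrow{d}\mathscr{R}\ \text{ as } a\downarrow 0\quad\Longleftrightarrow\quad \Delta(a)\sup_{t\ge 0}X^{(a)}_t\xrightarrow{d}\mathscr{R}\ \text{ as } a\downarrow 0.$$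
   Context: All random objects are defined on one probability space $(\Omega,\mathbb{F},\mathbb{P})$ endowed with a standard filtration $\mathcal{F}=\{\mathcal{F}_t:t\ge 0\}$ (an increasing, right-continuous family of complete sub-$\sigma$-fields of $\mathbb{F}$). A Lévy process $X=\{X_t:t\ge0\}$ is a real-valued process with $X_0=0$, adapted to $\mathcal{F}$, with càdlàg sample paths, such that for $0\le t<s$ the increment $X_s-X_t$ is independent of $\mathcal{F}_t$ and distributed as $X_{s-t}$. All Lévy processes considered are nondeterministic, i.e. $\sigma^2+\nu(\mathbb{R}\setminus\{0\})>0$, where $\sigma^2$ is the Gaussian coefficient and $\nu$ the Lévy measure. $\xrightarrow{d}$ denotes convergence in distribution. *)

theory Defs
  imports "HOL-Probability.Probability"
begin

text \<open>A filtration indexed by \<open>t \<ge> 0\<close> and satisfying the usual conditions. The measures \<open>F t\<close> serve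
  only as sigma-algebras, and their values at \<open>t < 0\<close> are irrelevant. Completeness means, as usual,
  that every \<open>F t\<close> contains all subsets of all null sets of \<open>M\<close>.\<close>

definition standard_filtration :: "'a measure \<Rightarrow> (real \<Rightarrow> 'a measure) \<Rightarrow> bool" where
  "standard_filtration M F \<longleftrightarrow>
     (\<forall>t\<ge>0. subalgebra M (F t)) \<and>
     (\<forall>s t. 0 \<le> s \<and> s \<le> t \<longrightarrow> sets (F s) \<subseteq> sets (F t)) \<and>
     (\<forall>t\<ge>0. sets (F t) = (\<Inter>s\<in>{t<..}. sets (F s))) \<and>
     (\<forall>t\<ge>0. \<forall>N\<in>null_sets M. Pow N \<subseteq> sets (F t))"

definition cadlag :: "(real \<Rightarrow> real) \<Rightarrow> bool" where
  "cadlag f \<longleftrightarrow>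
     (\<forall>t\<ge>0. (f \<longlongrightarrow> f t) (at_right t)) \<and>
     (\<forall>t>0. \<exists>l. (f \<longlongrightarrow> l) (at_left t))"

definition levy_process :: "'a measure \<Rightarrow> (real \<Rightarrow> 'a measure) \<Rightarrow> (real \<Rightarrow> 'a \<Rightarrow> real) \<Rightarrow> bool" where
  "levy_process M F X \<longleftrightarrow>
     (\<forall>\<omega>\<in>space M. X 0 \<omega> = 0) \<and>
     (\<forall>t\<ge>0. X t \<in> borel_measurable (F t)) \<and>
     (\<forall>\<omega>\<in>space M. cadlag (\<lambda>t. X t \<omega>)) \<and>
     (\<forall>t s. 0 \<le> t \<and> t < s \<longrightarrow>
        prob_space.indep_set M
          {(\<lambda>\<omega>. X s \<omega> - X t \<omega>) -` B \<inter> space M |B. B \<in> sets borel} (sets (F t)) \<and>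
        distr M borel (\<lambda>\<omega>. X s \<omega> - X t \<omega>) = distr M borel (X (s - t)))"

text \<open>A Levy measure on \<open>\<real> - {0}\<close> is encoded as a measure on the whole line that gives no mass to 0.\<close>

definition levy_measure :: "real measure \<Rightarrow> bool" where
  "levy_measure \<nu> \<longleftrightarrow>
     sets \<nu> = sets borel \<and> emeasure \<nu> {0} = 0 \<and> (\<integral>\<^sup>+x. ennreal (min 1 (x\<^sup>2)) \<partial>\<nu>) < \<infinity>"

definition levy_khintchine_exponent :: "real \<Rightarrow> real \<Rightarrow> real measure \<Rightarrow> real \<Rightarrow> complex" where
  "levy_khintchine_exponent b \<sigma> \<nu> \<theta> =
     \<i> * of_real (b * \<theta>) - of_real (\<sigma>\<^sup>2 * \<theta>\<^sup>2 / 2) +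
     (LINT x|\<nu>. exp (\<i> * of_real (\<theta> * x)) - 1 - \<i> * of_real (\<theta> * x * indicator {-1..1} x))"

text \<open>The characteristic triplet of a Levy process (drift \<open>b\<close>, Gaussian coefficient \<open>\<sigma>\<^sup>2\<close>, Levy measure
  \<open>\<nu>\<close>) is that of the infinitely divisible law of \<open>X 1\<close>; by the Levy--Khintchine theorem it exists
  and is unique, so that the existential quantifier in \<open>nondeterministic\<close> just names it.\<close>

definition characteristic_triplet ::
  "'a measure \<Rightarrow> (real \<Rightarrow> 'a \<Rightarrow> real) \<Rightarrow> real \<Rightarrow> real \<Rightarrow> real measure \<Rightarrow> bool" where
  "characteristic_triplet M X b \<sigma> \<nu> \<longleftrightarrow>
     \<sigma> \<ge> 0 \<and> levy_measure \<nu> \<and>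
     (\<forall>\<theta>. char (distr M borel (X 1)) \<theta> = exp (levy_khintchine_exponent b \<sigma> \<nu> \<theta>))"

definition nondeterministic :: "'a measure \<Rightarrow> (real \<Rightarrow> 'a \<Rightarrow> real) \<Rightarrow> bool" where
  "nondeterministic M X \<longleftrightarrow>
     (\<exists>b \<sigma> \<nu>. characteristic_triplet M X b \<sigma> \<nu> \<and> ennreal (\<sigma>\<^sup>2) + emeasure \<nu> (- {0}) > 0)"

text \<open>\<open>SUP\<close> is the real supremum, which has an unspecified value on unbounded sets. For a random walk
  or a Levy process with negative mean, paths tend almost surely to \<open>-\<infinity>\<close>; hence the supremum
  is almost surely the genuine finite one, and for the random walk it is almost surely a maximum.\<close>

definition all_time_sup :: "'t set \<Rightarrow> ('t \<Rightarrow> 'a \<Rightarrow> real) \<Rightarrow> 'a \<Rightarrow> real" where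
  "all_time_sup T Z \<omega> = (SUP t\<in>T. Z t \<omega>)"

text \<open>Convergence in distribution along an arbitrary filter, extending \<open>weak_conv_m\<close>, which
  covers sequences only.\<close>

definition converges_in_distribution ::
  "'a measure \<Rightarrow> ('i \<Rightarrow> 'a \<Rightarrow> real) \<Rightarrow> ('a \<Rightarrow> real) \<Rightarrow> 'i filter \<Rightarrow> bool" where
  "converges_in_distribution M Z R G \<longleftrightarrow>
     (\<forall>x. isCont (cdf (distr M borel R)) x \<longrightarrow>
        ((\<lambda>a. cdf (distr M borel (Z a)) x) \<longlongrightarrow> cdf (distr M borel R) x) G)"

lemma converges_in_distribution_sequentially:
  "converges_in_distribution M Z R sequentially \<longleftrightarrow>
     weak_conv_m (\<lambda>n. distr M borel (Z n)) (distr M borel R)"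
  by (simp add: converges_in_distribution_def weak_conv_m_def weak_conv_def)

end

theory Submission
  imports Defs
begin

text \<open>For fixed \<open>a\<close>, the walk \<open>S\<close> has the same law as the skeleton \<open>X 0, X 1, X 2, ...\<close> of the Levy process,
  so the theorem compares the supremum of one and the same process over the integers and over
  \<open>[0, \<infinity>)\<close>. The second supremum is the larger one. Conversely, suppose that the process exceeds \<open>u\<close>,
  and stop it when it does so for the first time. The part of the path up to the next
  integer is independent of the past and at most one time unit long. With a probability of at
  least \<open>q = inf {P(X t \<ge> - z) | 0 \<le> t \<le> 1}\<close> it loses at most \<open>z\<close>, so that the skeleton exceeds
  \<open>u - z\<close> at that integer:
  \<open>P(sup X > u) * q \<le> P(sup skeleton > u - z)\<close>. This is \<open>first_passage\<close>; it is proved on dyadic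
  grids, where first passage is a discrete event, and the mesh is then refined.

  It remains to see that \<open>q\<close> is close to 1 if \<open>X 1\<close> is small with high probability.
  As \<open>X 1\<close> is the sum of the independent variables \<open>X t\<close> and \<open>X 1 - X t\<close>, its smallness forces
  \<open>X t\<close> to be close to a constant \<open>c t\<close> (\<open>summand_concentrates\<close>). Stationarity makes \<open>c\<close> additive up to
  a small error, and \<open>c 1 = 0\<close>; on every finite grid in \<open>[0, 1]\<close> such a function is uniformly small
  (\<open>almost_additive_bounded\<close>). Hence (\<open>grid_values_small\<close>) no \<open>X t\<close> with \<open>t\<close> in the grid is large
  with a probability above that of \<open>X 1\<close> not being small.

  Together (\<open>skeleton_vs_process_bounded\<close>), the distribution functions \<open>G\<close> and \<open>H\<close> of the two normalized
  suprema satisfy \<open>G x \<le> H (x + z) + e\<close> and \<open>H x \<le> G (x + z) + e\<close>, where \<open>e\<close> is three times the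
  probability that \<open>\<Delta> a * X 1\<close> exceeds \<open>z / 10\<close> in absolute value. Almost sure
  convergence of \<open>\<Delta> a * X 1\<close> makes \<open>e\<close> vanish in the limit for every \<open>z\<close>, and so both families
  converge weakly to the same limits (\<open>interleaved_convergence\<close>).

  The negative mean makes both suprema finite almost surely. For the walk this is
  \<open>negative_drift_sums_bounded_above\<close>, a maximal ergodic argument; the process
  inherits it through the first passage inequality.\<close>

section \<open>Boundedness of random walks with negative drift\<close>

text \<open>The maximum of the partial sums \<open>x 0 + ... + x (k - 1)\<close> over \<open>k \<le> n\<close>, written as a recursion that
  removes the first step. In this form the maxima for a sequence and for its shift are related by one
  equation, which is what an argument by stationarity needs.\<close>

fun reflected_walk :: "nat \<Rightarrow> (nat \<Rightarrow> real) \<Rightarrow> real" where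
  "reflected_walk 0 x = 0"
| "reflected_walk (Suc n) x = max 0 (x 0 + reflected_walk n (\<lambda>i. x (Suc i)))"

lemma reflected_walk_nonneg: "0 \<le> reflected_walk n x"
  by (cases n) auto

lemma reflected_walk_le_Suc: "reflected_walk n x \<le> reflected_walk (Suc n) x"
proof (induction n arbitrary: x)
  case (Suc n)
  show ?case
    using Suc[of "\<lambda>i. x (Suc i)"]
    by (simp only: reflected_walk.simps(2))
qed simp

lemma partial_sum_le_reflected_walk: "(\<Sum>i<n. x i) \<le> reflected_walk n x"
proof (induction n arbitrary: x)
  case (Suc n)
  have "(\<Sum>i<Suc n. x i) = x 0 + (\<Sum>i<n. x (Suc i))"
    by (simp only: sum.lessThan_Suc_shift)
  also have "\<dots> \<le> x 0 + reflected_walk n (\<lambda>i. x (Suc i))"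
    using Suc by simp
  finally show ?case by simp
qed simp

lemma measurable_reflected_walk [measurable]:
  "reflected_walk n \<in> borel_measurable (\<Pi>\<^sub>M i\<in>UNIV. borel)"
proof (induction n)
  case (Suc n)
  note Suc.IH [measurable]
  have [measurable]: "(\<lambda>x i. x (Suc i)) \<in> measurable (\<Pi>\<^sub>M i\<in>UNIV. borel) (\<Pi>\<^sub>M i\<in>UNIV. borel :: real measure)"
    by (rule measurable_PiM_single') (auto simp: space_PiM)
  show ?case by (subst reflected_walk.simps(2)[abs_def]) measurable
qed simp

lemma filterlim_reflected_walk_at_top:
  assumes "\<forall>u. \<exists>n. u < (\<Sum>i<n. x i)"
  shows "filterlim (\<lambda>n. reflected_walk n x) at_top sequentially"
  unfolding filterlim_at_top eventually_sequentially
proof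
  fix Z
  obtain n where n: "Z < (\<Sum>i<n. x i)" using assms by blast
  have "Z \<le> reflected_walk m x" if "m \<ge> n" for m
  proof -
    have "reflected_walk n x \<le> reflected_walk m x"
      by (rule lift_Suc_mono_le[of "\<lambda>n. reflected_walk n x", OF _ that])
        (rule reflected_walk_le_Suc)
    then show ?thesis
      using n partial_sum_le_reflected_walk[where n=n and x=x] by linarith
  qed
  then show "\<exists>N. \<forall>m\<ge>N. Z \<le> reflected_walk m x" by blast
qed

text \<open>Unboundedness is a shift-invariant event; for an i.i.d. sequence it is therefore independent of
  the first step.\<close>

lemma unbounded_sums_shift_iff:
  fixes x :: "nat \<Rightarrow> real"
  shows "(\<forall>u. \<exists>n. u < (\<Sum>i<n. case_nat y x i)) \<longleftrightarrow> (\<forall>u. \<exists>n. u < (\<Sum>i<n. x i))"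
proof -
  have shift: "(\<Sum>i<Suc n. case_nat y x i) = y + (\<Sum>i<n. x i)" for n
    by (simp only: sum.lessThan_Suc_shift) simp
  show ?thesis
  proof (intro iffI allI)
    fix u assume "\<forall>u. \<exists>n. u < (\<Sum>i<n. case_nat y x i)"
    then obtain n where n: "max 0 (u + y) < (\<Sum>i<n. case_nat y x i)" by blast
    then obtain m where "n = Suc m" by (cases n) auto
    with n have "u < (\<Sum>i<m. x i)" using shift[of m] by simp
    then show "\<exists>n. u < (\<Sum>i<n. x i)" by blast
  next
    fix u assume "\<forall>u. \<exists>n. u < (\<Sum>i<n. x i)"
    then obtain n where "u - y < (\<Sum>i<n. x i)" by blast
    then have "u < (\<Sum>i<Suc n. case_nat y x i)" using shift[of n] by simp
    then show "\<exists>n. u < (\<Sum>i<n. case_nat y x i)" by blast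
  qed
qed

text \<open>Let \<open>A\<close> be the event of unbounded sums and \<open>W n\<close> the maximum of the first \<open>n\<close> sums. Write the
  sequence as a first step \<open>y\<close> followed by an independent copy \<open>x\<close> of the whole sequence. Then
  \<open>W (n + 1)\<close> is \<open>max 0 (y + W n x)\<close>, and \<open>E[W (n + 1); A] \<ge> E[W n; A]\<close> because \<open>W\<close> increases. By
  stationarity and invariance of \<open>A\<close>, the difference of the two sides is
  \<open>E[max y (- W n x); x \<in> A]\<close>. On \<open>A\<close> the maxima \<open>W n\<close> diverge, so the limit is
  \<open>E[y; x \<in> A] = E[y] * P(A)\<close>. This is nonnegative although \<open>E[y] < 0\<close>, hence \<open>P(A) = 0\<close>.\<close>

lemma negative_drift_sums_bounded_above:
  fixes \<nu> :: "real measure"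
  assumes "prob_space \<nu>" and sets_\<nu> [measurable_cong]: "sets \<nu> = sets borel"
    and int: "integrable \<nu> (\<lambda>y. y)" and neg: "(LINT y|\<nu>. y) < 0"
  shows "AE x in \<Pi>\<^sub>M i\<in>(UNIV::nat set). \<nu>. \<exists>u. \<forall>n. (\<Sum>i<n. x i) \<le> u"
proof -
  interpret \<nu>: prob_space \<nu> by fact
  interpret product_prob_space "\<lambda>_::nat. \<nu>" UNIV ..
  interpret sequence_space \<nu> ..
  interpret Q: pair_prob_space \<nu> S ..
  have [measurable_cong]: "sets S = sets (\<Pi>\<^sub>M i\<in>(UNIV::nat set). (borel::real measure))"
    by (intro sets_PiM_cong sets_\<nu>) simp
  define A where "A = {x::nat \<Rightarrow> real. \<forall>u. \<exists>n. u < (\<Sum>i<n. x i)}"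
  have "A = {x \<in> space S. \<forall>N::nat. \<exists>n. real N < (\<Sum>i<n. x i)}"
  proof -
    have "space S = UNIV" using sets_eq_imp_space_eq[OF sets_\<nu>] by (simp add: space_PiM)
    then show ?thesis
      unfolding A_def by auto (meson less_trans reals_Archimedean2)
  qed
  also have "\<dots> \<in> sets S" by measurable
  finally have A [measurable]: "A \<in> sets S" .
  define W :: "nat \<Rightarrow> (nat \<Rightarrow> real) \<Rightarrow> real" where "W = reflected_walk"
  have W [measurable]: "W n \<in> borel_measurable S" for n
    unfolding W_def by measurable
  have W_Suc: "W (Suc n) (case_nat y x) = max 0 (y + W n x)" for n y x
    by (simp add: W_def)
  have indA: "indicator A (case_nat y x) = (indicator A x :: real)" for y x
    unfolding A_def indicator_def using unbounded_sums_shift_iff[of y x] by simp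
  have iter: "(\<lambda>(s, \<omega>). case_nat s \<omega>) \<in> measurable (\<nu> \<Otimes>\<^sub>M S) S" by measurable
  \<comment> \<open>The law of an i.i.d. sequence is unchanged if an independent step is put in front.\<close>
  have int_iff: "integrable S f \<longleftrightarrow> integrable (\<nu> \<Otimes>\<^sub>M S) (\<lambda>p. f (case_nat (fst p) (snd p)))"
    and integral_eq: "(LINT x|S. f x) = (LINT p|(\<nu> \<Otimes>\<^sub>M S). f (case_nat (fst p) (snd p)))"
    if "f \<in> borel_measurable S" for f :: "(nat \<Rightarrow> real) \<Rightarrow> real"
    using integrable_distr_eq[OF iter that] integral_distr[OF iter that]
    unfolding PiM_iter by (simp_all add: case_prod_beta)
  have fst_int: "integrable (\<nu> \<Otimes>\<^sub>M S) (\<lambda>p. fst p)"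
    using int integrable_distr_eq[of fst "\<nu> \<Otimes>\<^sub>M S" \<nu> "\<lambda>y. y"] P.distr_pair_fst[of \<nu>]
    by (simp)
  have snd_int: "integrable (\<nu> \<Otimes>\<^sub>M S) (\<lambda>p. f (snd p))" and snd_eq: "(LINT p|(\<nu> \<Otimes>\<^sub>M S). f (snd p)) = (LINT x|S. f x)"
    if "integrable S f" for f :: "(nat \<Rightarrow> real) \<Rightarrow> real"
  proof -
    have [measurable]: "f \<in> borel_measurable S" using that by measurable
    show "integrable (\<nu> \<Otimes>\<^sub>M S) (\<lambda>p. f (snd p))"
      using that Q.integrable_product_swap_iff[of "\<lambda>p. f (snd p)"]
        integrable_distr_eq[of fst "S \<Otimes>\<^sub>M \<nu>" S f] \<nu>.distr_pair_fst[of S]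
      by (simp add: case_prod_beta')
    show "(LINT p|(\<nu> \<Otimes>\<^sub>M S). f (snd p)) = (LINT x|S. f x)"
      using Q.integral_product_swap[of "\<lambda>p. f (snd p)"]
        integral_distr[of fst "S \<Otimes>\<^sub>M \<nu>" S f] \<nu>.distr_pair_fst[of S]
      by (simp add: case_prod_beta')
  qed
  have W_int: "integrable S (W n)" for n
  proof (induction n)
    case 0 then show ?case by (simp add: W_def)
  next
    case (Suc n)
    show ?case
      by (subst int_iff) (auto simp: W_Suc intro!: integrable_max Bochner_Integration.integrable_add fst_int snd_int Suc)
  qed
  \<comment> \<open>The increment of the maxima on \<open>A\<close>, as a function of the first step and the remaining sequence.\<close>
  define D where "D n p = max (fst p) (- W n (snd p)) * indicator A (snd p)" for n p
  have fst_A_int: "integrable (\<nu> \<Otimes>\<^sub>M S) (\<lambda>p. fst p * indicator A (snd p))"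
    by (rule Bochner_Integration.integrable_bound[OF fst_int]) (auto simp: indicator_def)
  have D_int: "integrable (\<nu> \<Otimes>\<^sub>M S) (D n)" for n
    unfolding D_def
    by (rule Bochner_Integration.integrable_bound[OF integrable_max[OF fst_int integrable_minus[OF snd_int[OF W_int[of n]]]]])
       (auto simp: indicator_def)
  have D_nonneg: "0 \<le> (LINT p|(\<nu> \<Otimes>\<^sub>M S). D n p)" for n
  proof -
    have i1: "integrable S (\<lambda>x. W n x * indicator A x)" for n
      by (intro integrable_real_mult_indicator A W_int)
    have "(LINT x|S. W n x * indicator A x) \<le> (LINT x|S. W (Suc n) x * indicator A x)"
      using reflected_walk_le_Suc[of n] unfolding W_def[symmetric]
      by (intro integral_mono i1 mult_right_mono) auto
    also have "\<dots> = (LINT p|(\<nu> \<Otimes>\<^sub>M S). max 0 (fst p + W n (snd p)) * indicator A (snd p))"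
      by (subst integral_eq) (simp_all add: W_Suc indA)
    also have "\<dots> = (LINT p|(\<nu> \<Otimes>\<^sub>M S). D n p + W n (snd p) * indicator A (snd p))"
      by (intro Bochner_Integration.integral_cong) (auto simp: D_def max_def algebra_simps indicator_def)
    also have "\<dots> = (LINT p|(\<nu> \<Otimes>\<^sub>M S). D n p) + (LINT p|(\<nu> \<Otimes>\<^sub>M S). W n (snd p) * indicator A (snd p))"
      by (intro Bochner_Integration.integral_add D_int snd_int i1)
    also have "(LINT p|(\<nu> \<Otimes>\<^sub>M S). W n (snd p) * indicator A (snd p)) = (LINT x|S. W n x * indicator A x)"
      by (rule snd_eq[OF i1])
    finally show ?thesis by simp
  qed
  have "(\<lambda>n. LINT p|(\<nu> \<Otimes>\<^sub>M S). D n p) \<longlonglongrightarrow> (LINT p|(\<nu> \<Otimes>\<^sub>M S). fst p * indicator A (snd p))"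
  proof (rule integral_dominated_convergence[where w="\<lambda>p. \<bar>fst p\<bar>"])
    show "AE p in \<nu> \<Otimes>\<^sub>M S. (\<lambda>n. D n p) \<longlonglongrightarrow> fst p * indicator A (snd p)"
    proof (rule AE_I2)
      fix p :: "real \<times> (nat \<Rightarrow> real)"
      show "(\<lambda>n. D n p) \<longlonglongrightarrow> fst p * indicator A (snd p)"
      proof (cases "snd p \<in> A")
        case True
        then have "\<forall>\<^sub>F n in sequentially. - fst p \<le> W n (snd p)"
          using filterlim_reflected_walk_at_top[of "snd p"]
          unfolding A_def W_def filterlim_at_top by blast
        then have "\<forall>\<^sub>F n in sequentially. D n p = fst p * indicator A (snd p)"
          by eventually_elim (simp add: D_def)
        then show ?thesis by (rule tendsto_eventually)
      qed (simp add: D_def)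
    qed
    show "AE p in \<nu> \<Otimes>\<^sub>M S. norm (D n p) \<le> \<bar>fst p\<bar>" for n
    proof (rule AE_I2)
      fix p :: "real \<times> (nat \<Rightarrow> real)"
      have "0 \<le> W n (snd p)" by (simp add: W_def reflected_walk_nonneg)
      then have "\<bar>max (fst p) (- W n (snd p))\<bar> \<le> \<bar>fst p\<bar>" by linarith
      then show "norm (D n p) \<le> \<bar>fst p\<bar>" by (simp add: D_def indicator_def)
    qed
    show "integrable (\<nu> \<Otimes>\<^sub>M S) (\<lambda>p. \<bar>fst p\<bar>)" using fst_int by (rule integrable_abs)
  qed (use borel_measurable_integrable[OF fst_A_int] borel_measurable_integrable[OF D_int] in auto)
  then have "0 \<le> (LINT p|(\<nu> \<Otimes>\<^sub>M S). fst p * indicator A (snd p))"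
    using D_nonneg by (intro LIMSEQ_le_const) auto
  also have "\<dots> = (LINT y|\<nu>. LINT x|S. y * indicator A x)"
    using Q.integral_fst'[OF fst_A_int] by simp
  also have "\<dots> = (LINT y|\<nu>. y) * measure S A"
    by simp
  finally have "measure S A = 0"
    using neg by (simp add: zero_le_mult_iff measure_le_0_iff)
  then have "AE x in S. x \<notin> A"
    using A by (simp add: P.prob_eq_0)
  then show ?thesis
    by (simp add: A_def not_less)
qed

section \<open>Laws of independent steps and of unit increments\<close>

text \<open>Both the steps of the walk and the unit increments of the process are identified through this
  criterion. For the increments the product formula is what an induction over time yields directly.\<close>

lemma (in prob_space) sequence_law_eq_PiM:
  fixes \<xi> :: "nat \<Rightarrow> 'a \<Rightarrow> real"
  assumes \<nu>: "prob_space \<nu>" and sets_\<nu>: "sets \<nu> = sets borel"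
    and rv [measurable]: "\<And>i. \<xi> i \<in> borel_measurable M"
    and factor: "\<And>J B. finite J \<Longrightarrow> (\<And>j. j \<in> J \<Longrightarrow> B j \<in> sets borel) \<Longrightarrow>
      prob {\<omega> \<in> space M. \<forall>j\<in>J. \<xi> j \<omega> \<in> B j} = (\<Prod>j\<in>J. measure \<nu> (B j))"
  shows "distr M (\<Pi>\<^sub>M i\<in>UNIV. borel) (\<lambda>\<omega> i. \<xi> i \<omega>) = (\<Pi>\<^sub>M i\<in>UNIV. \<nu>)"
proof -
  interpret \<nu>: prob_space \<nu> by fact
  interpret Q: product_prob_space "\<lambda>_::nat. \<nu>" UNIV ..
  have [measurable]: "(\<lambda>\<omega> i. \<xi> i \<omega>) \<in> measurable M (\<Pi>\<^sub>M i\<in>UNIV. borel)"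
    by (rule measurable_PiM_single') (auto simp: space_PiM)
  have sets_eq: "sets (\<Pi>\<^sub>M i\<in>UNIV. borel :: real measure) = sets (\<Pi>\<^sub>M i\<in>(UNIV::nat set). \<nu>)"
    by (intro sets_PiM_cong) (simp_all add: sets_\<nu>)
  show ?thesis
  proof (rule Q.PiM_eq)
    show "sets (distr M (\<Pi>\<^sub>M i\<in>UNIV. borel) (\<lambda>\<omega> i. \<xi> i \<omega>)) = sets (\<Pi>\<^sub>M i\<in>UNIV. \<nu>)"
      by (simp add: sets_eq)
  next
    fix J :: "nat set" and B :: "nat \<Rightarrow> real set"
    assume J: "finite J" "J \<subseteq> UNIV" and B: "\<And>i. i \<in> J \<Longrightarrow> B i \<in> sets \<nu>"
    have emb: "prod_emb UNIV (\<lambda>_. \<nu>) J (Pi\<^sub>E J B) \<in> sets (\<Pi>\<^sub>M i\<in>UNIV. borel :: real measure)"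
      unfolding sets_eq using J B by (intro sets_PiM_I) auto
    have vimage: "(\<lambda>\<omega> i. \<xi> i \<omega>) -` prod_emb UNIV (\<lambda>_. \<nu>) J (Pi\<^sub>E J B) \<inter> space M =
        {\<omega> \<in> space M. \<forall>j\<in>J. \<xi> j \<omega> \<in> B j}"
      using sets_eq_imp_space_eq[OF sets_\<nu>] by (auto simp: prod_emb_def space_PiM PiE_iff)
    show "emeasure (distr M (\<Pi>\<^sub>M i\<in>UNIV. borel) (\<lambda>\<omega> i. \<xi> i \<omega>)) (prod_emb UNIV (\<lambda>_. \<nu>) J (Pi\<^sub>E J B)) =
        (\<Prod>i\<in>J. emeasure \<nu> (B i))"
      using factor[OF J(1), of B] B J(1)
      by (simp add: emeasure_distr emb vimage emeasure_eq_measure \<nu>.emeasure_eq_measure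
          prod_ennreal sets_\<nu>)
  qed
qed

locale levy = prob_space M for M :: "'a measure" +
  fixes F :: "real \<Rightarrow> 'a measure" and X :: "real \<Rightarrow> 'a \<Rightarrow> real"
  assumes filtration: "standard_filtration M F"
    and levy: "levy_process M F X"
begin

lemma subalgebra_F: "0 \<le> t \<Longrightarrow> subalgebra M (F t)"
  using filtration[unfolded standard_filtration_def, THEN conjunct1] by simp

lemma space_F: "0 \<le> t \<Longrightarrow> space (F t) = space M"
  using subalgebra_F by (simp add: subalgebra_def)

lemma sets_F_mono: "0 \<le> s \<Longrightarrow> s \<le> t \<Longrightarrow> sets (F s) \<subseteq> sets (F t)"
  using filtration[unfolded standard_filtration_def, THEN conjunct2, THEN conjunct1] by simp

lemma process_0: "\<omega> \<in> space M \<Longrightarrow> X 0 \<omega> = 0"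
  using levy by (auto simp: levy_process_def)

lemma adapted:
  assumes "0 \<le> s" "s \<le> t"
  shows "X s \<in> borel_measurable (F t)"
proof -
  have "X s \<in> borel_measurable (F s)" using levy assms by (simp add: levy_process_def)
  moreover have "subalgebra (F t) (F s)"
    using assms by (simp add: subalgebra_def space_F sets_F_mono)
  ultimately show ?thesis by (rule measurable_from_subalg[rotated])
qed

lemma process_measurable: "0 \<le> t \<Longrightarrow> X t \<in> borel_measurable M"
  using measurable_from_subalg[OF subalgebra_F adapted] by blast

lemma path_right_continuous:
  "\<omega> \<in> space M \<Longrightarrow> 0 \<le> t \<Longrightarrow> ((\<lambda>s. X s \<omega>) \<longlongrightarrow> X t \<omega>) (at_right t)"
  using levy by (auto simp: levy_process_def cadlag_def)

lemma prob_increment: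
  assumes t: "0 \<le> t" "t < s" and B: "B \<in> sets borel"
  shows "prob {\<omega> \<in> space M. X s \<omega> - X t \<omega> \<in> B} = prob {\<omega> \<in> space M. X (s - t) \<omega> \<in> B}"
proof -
  have law: "distr M borel (\<lambda>\<omega>. X s \<omega> - X t \<omega>) = distr M borel (X (s - t))"
    using levy t by (auto simp: levy_process_def)
  have [measurable]: "X s \<in> borel_measurable M" "X t \<in> borel_measurable M"
    "X (s - t) \<in> borel_measurable M"
    using t by (auto intro: process_measurable)
  have "measure (distr M borel (\<lambda>\<omega>. X s \<omega> - X t \<omega>)) B = measure (distr M borel (X (s - t))) B"
    by (simp only: law)
  then show ?thesis
    using B by (simp add: measure_distr vimage_def Int_def conj_commute)
qed

text \<open>The simple Markov property in the form in which it is used throughout.\<close>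

lemma prob_past_and_increment:
  assumes t: "0 \<le> t" "t < s" and B: "B \<in> sets borel" and A: "A \<in> sets (F t)"
  shows "prob (A \<inter> {\<omega> \<in> space M. X s \<omega> - X t \<omega> \<in> B}) = prob A * prob {\<omega> \<in> space M. X (s - t) \<omega> \<in> B}"
proof -
  have "indep_set {(\<lambda>\<omega>. X s \<omega> - X t \<omega>) -` B \<inter> space M |B. B \<in> sets borel} (sets (F t))"
    using levy t by (auto simp: levy_process_def)
  then have "prob (((\<lambda>\<omega>. X s \<omega> - X t \<omega>) -` B \<inter> space M) \<inter> A) =
      prob ((\<lambda>\<omega>. X s \<omega> - X t \<omega>) -` B \<inter> space M) * prob A"
    by (rule indep_setD) (use A B in auto)
  also have "(\<lambda>\<omega>. X s \<omega> - X t \<omega>) -` B \<inter> space M = {\<omega> \<in> space M. X s \<omega> - X t \<omega> \<in> B}"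
    by auto
  finally show ?thesis
    using prob_increment[OF t B] by (simp add: Int_commute mult.commute)
qed

text \<open>The largest index is split off first: all earlier increments are known at the time
  at which that increment begins.\<close>

lemma unit_increments_law:
  "distr M (\<Pi>\<^sub>M i\<in>UNIV. borel) (\<lambda>\<omega> i. X (real i + 1) \<omega> - X (real i) \<omega>) =
    (\<Pi>\<^sub>M i\<in>(UNIV::nat set). distr M borel (X 1))"
proof (rule sequence_law_eq_PiM)
  have X1 [measurable]: "X 1 \<in> borel_measurable M" by (simp add: process_measurable)
  show "prob_space (distr M borel (X 1))" by (rule prob_space_distr) simp
  show "sets (distr M borel (X 1)) = sets borel" by simp
  show "(\<lambda>\<omega>. X (real i + 1) \<omega> - X (real i) \<omega>) \<in> borel_measurable M" for i
    by (intro borel_measurable_diff process_measurable) auto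
  fix J :: "nat set" and B :: "nat \<Rightarrow> real set"
  assume "finite J" and "\<And>j. j \<in> J \<Longrightarrow> B j \<in> sets borel"
  then show "prob {\<omega> \<in> space M. \<forall>j\<in>J. X (real j + 1) \<omega> - X (real j) \<omega> \<in> B j} =
      (\<Prod>j\<in>J. measure (distr M borel (X 1)) (B j))"
  proof (induction J rule: finite_linorder_max_induct)
    case empty
    then show ?case by (simp add: prob_space)
  next
    case (insert b J)
    define A where "A = {\<omega> \<in> space M. \<forall>j\<in>J. X (real j + 1) \<omega> - X (real j) \<omega> \<in> B j}"
    have "A = {\<omega> \<in> space (F b). \<forall>j\<in>J. X (real j + 1) \<omega> - X (real j) \<omega> \<in> B j}"
      by (simp add: A_def space_F)
    also have "\<dots> \<in> sets (F b)"
    proof (rule sets.sets_Collect_finite_All[OF _ \<open>finite J\<close>])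
      fix j assume j: "j \<in> J"
      then have "real j + 1 \<le> real b" using insert.hyps(2) by fastforce
      then have [measurable]: "X (real j + 1) \<in> borel_measurable (F b)" "X (real j) \<in> borel_measurable (F b)"
        by (auto intro!: adapted)
      have [measurable]: "B j \<in> sets borel" using insert.prems j by auto
      show "{\<omega> \<in> space (F b). X (real j + 1) \<omega> - X (real j) \<omega> \<in> B j} \<in> sets (F b)"
        by measurable
    qed
    finally have A: "A \<in> sets (F b)" .
    have B: "B b \<in> sets borel" using insert.prems by auto
    have "{\<omega> \<in> space M. \<forall>j\<in>insert b J. X (real j + 1) \<omega> - X (real j) \<omega> \<in> B j} =
        A \<inter> {\<omega> \<in> space M. X (real b + 1) \<omega> - X (real b) \<omega> \<in> B b}"
      by (auto simp: A_def)
    then have "prob {\<omega> \<in> space M. \<forall>j\<in>insert b J. X (real j + 1) \<omega> - X (real j) \<omega> \<in> B j} =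
        prob A * prob {\<omega> \<in> space M. X 1 \<omega> \<in> B b}"
      using prob_past_and_increment[OF _ _ B A, of "real b + 1"] by simp
    also have "prob A = (\<Prod>j\<in>J. measure (distr M borel (X 1)) (B j))"
      unfolding A_def using insert by auto
    also have "prob {\<omega> \<in> space M. X 1 \<omega> \<in> B b} = measure (distr M borel (X 1)) (B b)"
      using B by (simp add: measure_distr vimage_def Int_def conj_commute)
    finally show ?case
      using insert.hyps by (subst prod.insert) auto
  qed
qed

end

lemma (in prob_space) iid_sequence_law:
  fixes Y :: "nat \<Rightarrow> 'a \<Rightarrow> real"
  assumes indep: "indep_vars (\<lambda>_. borel) Y {1..}"
    and ident: "\<And>n. n \<ge> 1 \<Longrightarrow> distr M borel (Y n) = \<nu>"
  shows "distr M (\<Pi>\<^sub>M i\<in>UNIV. borel) (\<lambda>\<omega> i. Y (Suc i) \<omega>) = (\<Pi>\<^sub>M i\<in>(UNIV::nat set). \<nu>)"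
proof (rule sequence_law_eq_PiM)
  have rv [measurable]: "Y n \<in> borel_measurable M" if "n \<ge> 1" for n
    using indep that by (auto simp: indep_vars_def)
  show "(\<lambda>\<omega>. Y (Suc i) \<omega>) \<in> borel_measurable M" for i by (simp add: rv)
  show "prob_space \<nu>" "sets \<nu> = sets borel"
    unfolding ident[of 1, OF order_refl, symmetric] by (auto intro: prob_space_distr rv)
  fix J :: "nat set" and B :: "nat \<Rightarrow> real set"
  assume J: "finite J" and B: "\<And>j. j \<in> J \<Longrightarrow> B j \<in> sets borel"
  show "prob {\<omega> \<in> space M. \<forall>j\<in>J. Y (Suc j) \<omega> \<in> B j} = (\<Prod>j\<in>J. measure \<nu> (B j))"
  proof (cases "J = {}")
    case True
    then show ?thesis by (simp add: prob_space)
  next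
    case False
    have "{\<omega> \<in> space M. \<forall>j\<in>J. Y (Suc j) \<omega> \<in> B j} = (\<Inter>n\<in>Suc ` J. Y n -` B (n - 1) \<inter> space M)"
      using False by auto
    then have "prob {\<omega> \<in> space M. \<forall>j\<in>J. Y (Suc j) \<omega> \<in> B j} = prob (\<Inter>n\<in>Suc ` J. Y n -` B (n - 1) \<inter> space M)"
      by simp
    also have "\<dots> = (\<Prod>n\<in>Suc ` J. prob (Y n -` B (n - 1) \<inter> space M))"
      using indep by (rule indep_varsD) (use J B False in auto)
    also have "\<dots> = (\<Prod>j\<in>J. prob (Y (Suc j) -` B j \<inter> space M))"
      by (simp add: prod.reindex)
    also have "\<dots> = (\<Prod>j\<in>J. measure \<nu> (B j))"
    proof (rule prod.cong[OF refl])
      fix j assume "j \<in> J"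
      then show "prob (Y (Suc j) -` B j \<inter> space M) = measure \<nu> (B j)"
        using measure_distr[OF rv[of "Suc j"], of "B j"] ident[of "Suc j"] B by simp
    qed
    finally show ?thesis .
  qed
qed

section \<open>Smallness of a Levy process on the unit interval\<close>

text \<open>If no constant worked, then for every value \<open>v\<close> of \<open>V\<close> the sum \<open>U + v\<close> would exceed \<open>\<epsilon>\<close> in absolute
  value with probability above \<open>\<eta>\<close>; integrating over the law of \<open>V\<close> contradicts the assumption.\<close>

lemma (in prob_space) summand_concentrates:
  fixes U V :: "'a \<Rightarrow> real"
  assumes indep: "indep_var borel U borel V"
    and small: "prob {\<omega> \<in> space M. \<epsilon> < \<bar>U \<omega> + V \<omega>\<bar>} \<le> \<eta>"
  shows "\<exists>c. prob {\<omega> \<in> space M. \<epsilon> < \<bar>U \<omega> - c\<bar>} \<le> \<eta>"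
proof (rule ccontr)
  assume "\<not> ?thesis"
  then have large: "\<eta> < prob {\<omega> \<in> space M. \<epsilon> < \<bar>U \<omega> - c\<bar>}" for c
    by (simp add: not_le)
  have [measurable]: "U \<in> borel_measurable M" "V \<in> borel_measurable M"
    using indep_var_rv1[OF indep] indep_var_rv2[OF indep] by auto
  define PU PV where "PU = distr M borel U" and "PV = distr M borel V"
  have [measurable_cong]: "sets PU = sets borel" "sets PV = sets borel"
    by (simp_all add: PU_def PV_def)
  interpret PU: prob_space PU unfolding PU_def by (rule prob_space_distr) simp
  interpret PV: prob_space PV unfolding PV_def by (rule prob_space_distr) simp
  interpret Q: pair_prob_space PU PV ..
  define g :: "real \<Rightarrow> real \<Rightarrow> real" where "g u v = indicator {x. \<epsilon> < \<bar>x\<bar>} (u + v)" for u v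
  have g_meas [measurable]: "case_prod g \<in> borel_measurable (borel \<Otimes>\<^sub>M borel)"
    unfolding g_def by measurable
  have g_int: "integrable (PU \<Otimes>\<^sub>M PV) (case_prod g)"
    by (rule Q.integrable_const_bound[of _ 1]) (auto simp: g_def indicator_def)
  have inner: "(LINT u|PU. g u v) = prob {\<omega> \<in> space M. \<epsilon> < \<bar>U \<omega> - (- v)\<bar>}" for v
  proof -
    have "(LINT u|PU. g u v) = (LINT \<omega>|M. g (U \<omega>) v)"
      unfolding PU_def by (rule integral_distr) (simp_all add: g_def)
    also have "\<dots> = (LINT \<omega>|M. indicator {\<omega> \<in> space M. \<epsilon> < \<bar>U \<omega> - (- v)\<bar>} \<omega>)"
      by (intro Bochner_Integration.integral_cong) (auto simp: g_def indicator_def)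
    finally show ?thesis by simp
  qed
  have "\<eta> < (LINT v|PV. LINT u|PU. g u v)"
    by (rule PV.expectation_greater[OF Q.integrable_snd[OF g_int]]) (simp only: inner large AE_I2)
  also have "\<dots> = (LINT p|(PU \<Otimes>\<^sub>M PV). case_prod g p)"
    by (rule Q.integral_snd[OF g_int])
  also have "PU \<Otimes>\<^sub>M PV = distr M (borel \<Otimes>\<^sub>M borel) (\<lambda>\<omega>. (U \<omega>, V \<omega>))"
    using indep unfolding indep_var_distribution_eq PU_def PV_def by simp
  also have "(LINT p|distr M (borel \<Otimes>\<^sub>M borel) (\<lambda>\<omega>. (U \<omega>, V \<omega>)). case_prod g p) = (LINT \<omega>|M. g (U \<omega>) (V \<omega>))"
    by (subst integral_distr[OF _ g_meas]) simp_all
  also have "\<dots> = (LINT \<omega>|M. indicator {\<omega> \<in> space M. \<epsilon> < \<bar>U \<omega> + V \<omega>\<bar>} \<omega>)"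
    by (intro Bochner_Integration.integral_cong) (auto simp: g_def indicator_def)
  finally show False using small by simp
qed

text \<open>Let \<open>K\<close> be the maximum of \<open>\<bar>f\<bar>\<close>. Doubling bounds \<open>f\<close> by \<open>(K + \<delta>) / 2\<close> on the first half of the grid,
  and \<open>f N = 0\<close> carries this bound to the second half by reflection, at the cost of a
  further \<open>\<delta>\<close>. So \<open>K \<le> (K + 3 * \<delta>) / 2\<close>; as the grid is finite, \<open>K\<close> is finite and can be subtracted.\<close>

lemma almost_additive_bounded:
  fixes f :: "nat \<Rightarrow> real"
  assumes add: "\<And>i j. 1 \<le> i \<Longrightarrow> 1 \<le> j \<Longrightarrow> i + j \<le> N \<Longrightarrow> \<bar>f (i + j) - f i - f j\<bar> \<le> \<delta>"
    and N: "f N = 0" and \<delta>: "0 \<le> \<delta>" and j: "1 \<le> j" "j \<le> N"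
  shows "\<bar>f j\<bar> \<le> 3 * \<delta>"
proof -
  define K where "K = Max ((\<lambda>i. \<bar>f i\<bar>) ` {1..N})"
  have K: "\<bar>f i\<bar> \<le> K" if "1 \<le> i" "i \<le> N" for i
    unfolding K_def using that by (intro Max_ge) auto
  have half: "\<bar>f i\<bar> \<le> (K + \<delta>) / 2" if "1 \<le> i" "2 * i \<le> N" for i
  proof -
    have i: "i + i \<le> N" "1 \<le> i + i" using that by simp_all
    show ?thesis using add[OF that(1) that(1) i(1)] K[OF i(2) i(1)]
      unfolding abs_le_iff by auto
  qed
  have step: "\<bar>f i\<bar> \<le> (K + 3 * \<delta>) / 2" if i: "1 \<le> i" "i \<le> N" for i
  proof (cases "2 * i \<le> N")
    case True
    then show ?thesis using half[OF i(1) True] \<delta> by (auto simp: field_simps)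
  next
    case False
    show ?thesis
    proof (cases "i = N")
      case True
      have "0 \<le> K" using K[OF i] by simp
      then show ?thesis using True N \<delta> by simp
    next
      case False
      then have ni: "1 \<le> N - i" "2 * (N - i) \<le> N" "N - i + i = N"
        using \<open>\<not> 2 * i \<le> N\<close> i by simp_all
      have "\<bar>f N - f (N - i) - f i\<bar> \<le> \<delta>"
        using add[OF ni(1) i(1)] ni(3) by simp
      then show ?thesis using half[OF ni(1,2)] N
        unfolding abs_le_iff by auto
    qed
  qed
  have "K \<in> (\<lambda>i. \<bar>f i\<bar>) ` {1..N}"
    unfolding K_def using j by (intro Max_in) auto
  then obtain i where "K = \<bar>f i\<bar>" "1 \<le> i" "i \<le> N" by auto
  then have "K \<le> (K + 3 * \<delta>) / 2" using step[of i] by simp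
  then have "K \<le> 3 * \<delta>" by (simp add: field_simps)
  then show ?thesis using K[OF j] by simp
qed

context levy
begin

lemma indep_value_increment:
  assumes t: "0 \<le> t" "t < s"
  shows "indep_var borel (X t) borel (\<lambda>\<omega>. X s \<omega> - X t \<omega>)"
proof -
  have [measurable]: "X t \<in> borel_measurable M" "X s \<in> borel_measurable M"
    using t by (auto intro: process_measurable)
  have Xt: "X t -` A \<inter> space M \<in> sets (F t)" if "A \<in> sets borel" for A
    using measurable_sets[OF adapted[of t t] that] t by (simp add: space_F)
  have stable: "Int_stable {f -` A \<inter> space M |A. A \<in> sets borel}" for f :: "'a \<Rightarrow> real"
  proof (rule Int_stableI)
    fix a b assume "a \<in> {f -` A \<inter> space M |A. A \<in> sets borel}" "b \<in> {f -` A \<inter> space M |A. A \<in> sets borel}"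
    then obtain A B where "a = f -` A \<inter> space M" "b = f -` B \<inter> space M" "A \<in> sets borel" "B \<in> sets borel"
      by blast
    then have "a \<inter> b = f -` (A \<inter> B) \<inter> space M" "A \<inter> B \<in> sets borel" by auto
    then show "a \<inter> b \<in> {f -` A \<inter> space M |A. A \<in> sets borel}" by blast
  qed
  have "indep_set {X t -` A \<inter> space M |A. A \<in> sets borel}
      {(\<lambda>\<omega>. X s \<omega> - X t \<omega>) -` A \<inter> space M |A. A \<in> sets borel}"
  proof (rule indep_setI)
    fix a b assume "a \<in> {X t -` A \<inter> space M |A. A \<in> sets borel}"
      "b \<in> {(\<lambda>\<omega>. X s \<omega> - X t \<omega>) -` A \<inter> space M |A. A \<in> sets borel}"
    then obtain A B where a: "a = X t -` A \<inter> space M" "A \<in> sets borel"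
      and b: "b = (\<lambda>\<omega>. X s \<omega> - X t \<omega>) -` B \<inter> space M" and B: "B \<in> sets borel" by blast
    have b': "b = {\<omega> \<in> space M. X s \<omega> - X t \<omega> \<in> B}" by (auto simp: b)
    show "prob (a \<inter> b) = prob a * prob b"
      unfolding b' prob_increment[OF t B]
      by (rule prob_past_and_increment[OF t B]) (use Xt a in simp)
  qed (auto intro!: measurable_sets)
  then show ?thesis
    unfolding indep_var_eq by (intro conjI indep_set_sigma_sets stable) measurable
qed

text \<open>The condition on \<open>\<eta>\<close> lets three events of probability at least \<open>1 - \<eta>\<close> meet in one outcome. There the
  centres of \<open>X\<close> at two times and at their sum can be compared, each up to \<open>\<epsilon>\<close>. The centres are
  thus additive up to \<open>3 * \<epsilon>\<close> and bounded by \<open>9 * \<epsilon>\<close>; the factor 10 adds the distance of \<open>X\<close> to its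
  centre.\<close>

lemma grid_values_small:
  assumes N: "1 \<le> j" "j \<le> N"
    and \<eta>: "\<eta> = prob {\<omega> \<in> space M. \<epsilon> < \<bar>X 1 \<omega>\<bar>}" "3 * \<eta> < 1" and \<epsilon>: "0 \<le> \<epsilon>"
  shows "prob {\<omega> \<in> space M. 10 * \<epsilon> < \<bar>X (real j / real N) \<omega>\<bar>} \<le> \<eta>"
proof -
  define x where "x i = X (real i / real N)" for i
  have [measurable]: "x i \<in> borel_measurable M" for i
    unfolding x_def by (rule process_measurable) simp
  have xN: "x N = X 1" using N by (simp add: x_def)
  have "\<exists>c. prob {\<omega> \<in> space M. \<epsilon> < \<bar>x i \<omega> - c\<bar>} \<le> \<eta>" if "i < N" for i
  proof (rule summand_concentrates)
    show "indep_var borel (x i) borel (\<lambda>\<omega>. x N \<omega> - x i \<omega>)"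
      unfolding x_def using that by (intro indep_value_increment) (auto simp: divide_simps)
  qed (simp add: xN \<eta>(1))
  then obtain g where g: "\<And>i. i < N \<Longrightarrow> prob {\<omega> \<in> space M. \<epsilon> < \<bar>x i \<omega> - g i\<bar>} \<le> \<eta>"
    by metis
  \<comment> \<open>Zero is a centre at time 1 by assumption; fixing it there anchors the additive function.\<close>
  define f where "f i = (if i = N then 0 else g i)" for i
  have f: "prob {\<omega> \<in> space M. \<epsilon> < \<bar>x i \<omega> - f i\<bar>} \<le> \<eta>" if "i \<le> N" for i
    using g[of i] that by (auto simp: f_def xN \<eta>(1))
  have add: "\<bar>f (i + k) - f i - f k\<bar> \<le> 3 * \<epsilon>" if ik: "1 \<le> i" "1 \<le> k" "i + k \<le> N" for i k
  proof -
    define A where "A = {\<omega> \<in> space M. \<epsilon> < \<bar>x i \<omega> - f i\<bar>}"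
    define B where "B = {\<omega> \<in> space M. \<epsilon> < \<bar>x (i + k) \<omega> - f (i + k)\<bar>}"
    define C where "C = {\<omega> \<in> space M. x (i + k) \<omega> - x i \<omega> \<in> {y. \<epsilon> < \<bar>y - f k\<bar>}}"
    have meas: "A \<in> events" "B \<in> events" "C \<in> events"
      unfolding A_def B_def C_def by measurable
    have diff: "real (i + k) / real N - real i / real N = real k / real N"
      by (simp add: diff_divide_distrib[symmetric])
    have "prob C = prob {\<omega> \<in> space M. x k \<omega> \<in> {y. \<epsilon> < \<bar>y - f k\<bar>}}"
      unfolding C_def x_def diff[symmetric]
      using ik by (intro prob_increment) (auto simp: divide_strict_right_mono)
    then have "prob C \<le> \<eta>" using f[of k] ik by simp
    moreover have "prob A \<le> \<eta>" "prob B \<le> \<eta>"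
      unfolding A_def B_def using f ik by auto
    moreover have "prob (A \<union> B \<union> C) \<le> prob A + prob B + prob C"
      using measure_Un_le[of "A \<union> B" M C] measure_Un_le[of A M B] meas by auto
    ultimately have "prob (A \<union> B \<union> C) < prob (space M)"
      using \<eta>(2) by (simp add: prob_space)
    then have "A \<union> B \<union> C \<noteq> space M" by auto
    moreover have "A \<union> B \<union> C \<subseteq> space M" by (auto simp: A_def B_def C_def)
    ultimately obtain \<omega> where "\<omega> \<in> space M" "\<omega> \<notin> A \<union> B \<union> C" by blast
    then have "\<bar>x i \<omega> - f i\<bar> \<le> \<epsilon>" "\<bar>x (i + k) \<omega> - f (i + k)\<bar> \<le> \<epsilon>" "\<bar>x (i + k) \<omega> - x i \<omega> - f k\<bar> \<le> \<epsilon>"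
      by (auto simp: A_def B_def C_def)
    then show ?thesis by linarith
  qed
  have "\<bar>f j\<bar> \<le> 3 * (3 * \<epsilon>)"
    by (rule almost_additive_bounded[where N = N]) (use add N \<epsilon> in \<open>auto simp: f_def\<close>)
  then have "prob {\<omega> \<in> space M. 10 * \<epsilon> < \<bar>x j \<omega>\<bar>} \<le> prob {\<omega> \<in> space M. \<epsilon> < \<bar>x j \<omega> - f j\<bar>}"
    by (intro finite_measure_mono) (auto, measurable)
  also have "\<dots> \<le> \<eta>" using f N by simp
  finally show ?thesis by (simp add: x_def)
qed

end

section \<open>First passage and the comparison of process and skeleton\<close>

context levy
begin

text \<open>The event that the grid points exceed \<open>u\<close> is split according to the first such point \<open>k / N\<close>. The
  path is followed up to the next integer strictly after \<open>k / N\<close>, which is at distance \<open>j / N\<close> with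
  \<open>1 \<le> j \<le> N\<close>; strictness avoids the degenerate increment of length 0.\<close>

lemma first_passage_on_grid:
  assumes N: "0 < N"
    and q: "\<And>j. 1 \<le> j \<Longrightarrow> j \<le> N \<Longrightarrow> q \<le> prob {\<omega> \<in> space M. - z \<le> X (real j / real N) \<omega>}"
  shows "prob {\<omega> \<in> space M. \<exists>k::nat. u < X (real k / real N) \<omega>} * q \<le>
    prob {\<omega> \<in> space M. \<exists>n::nat. u - z < X (real n) \<omega>}"
proof -
  define x where "x k = X (real k / real N)" for k
  define n where "n k = real (k div N + 1)" for k
  have x_meas [measurable]: "x k \<in> borel_measurable M" for k
    unfolding x_def by (rule process_measurable) simp
  have X_nat [measurable]: "X (real m) \<in> borel_measurable M" for m
    by (rule process_measurable) simp
  have n_meas [measurable]: "X (n k) \<in> borel_measurable M" for k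
    unfolding n_def by (rule X_nat)
  \<comment> \<open>First passage at grid point \<open>k\<close>, and the same event together with a good increment afterwards.\<close>
  define A where "A k = {\<omega> \<in> space M. (\<forall>i<k. x i \<omega> \<le> u) \<and> u < x k \<omega>}" for k
  define C where "C k = A k \<inter> {\<omega> \<in> space M. X (n k) \<omega> - x k \<omega> \<in> {- z..}}" for k
  have A_F: "A k \<in> sets (F (real k / real N))" for k
  proof -
    let ?t = "real k / real N"
    have x_F: "x i \<in> borel_measurable (F ?t)" if "i \<le> k" for i
      unfolding x_def using that by (intro adapted) (simp_all add: divide_right_mono)
    have "{\<omega> \<in> space (F ?t). \<forall>i\<in>{..<k}. x i \<omega> \<le> u} \<in> sets (F ?t)"
      by (rule sets.sets_Collect_finite_All)
        (simp_all add: borel_measurable_le x_F)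
    moreover have "{\<omega> \<in> space (F ?t). u < x k \<omega>} \<in> sets (F ?t)"
      by (rule borel_measurable_less) (simp_all add: x_F)
    ultimately have "{\<omega> \<in> space (F ?t). \<forall>i\<in>{..<k}. x i \<omega> \<le> u} \<inter> {\<omega> \<in> space (F ?t). u < x k \<omega>} \<in> sets (F ?t)"
      by (rule sets.Int)
    also have "space (F ?t) = space M" by (rule space_F) simp
    also have "{\<omega> \<in> space M. \<forall>i\<in>{..<k}. x i \<omega> \<le> u} \<inter> {\<omega> \<in> space M. u < x k \<omega>} = A k"
      by (auto simp: A_def)
    finally show ?thesis .
  qed
  have A_meas [measurable]: "A k \<in> events" for k
    unfolding A_def by measurable
  have C_meas [measurable]: "C k \<in> events" for k
    unfolding C_def by measurable
  have A_disj: "disjoint_family A"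
    unfolding disjoint_family_on_def
  proof (intro ballI impI)
    fix i j :: nat assume "i \<noteq> j"
    then show "A i \<inter> A j = {}"
      by (cases i j rule: linorder_cases) (auto simp: A_def not_less[symmetric])
  qed
  then have C_disj: "disjoint_family C"
    by (rule disjoint_family_on_bisimulation) (auto simp: C_def)
  have UN_A: "(\<Union>k. A k) = {\<omega> \<in> space M. \<exists>k. u < x k \<omega>}"
  proof safe
    fix \<omega> k assume "\<omega> \<in> space M" "u < x k \<omega>"
    then have "\<omega> \<in> A (LEAST k. u < x k \<omega>)"
      unfolding A_def by (auto intro: LeastI dest: not_less_Least simp: not_less)
    then show "\<omega> \<in> (\<Union>k. A k)" by blast
  qed (auto simp: A_def)
  have le: "prob (A k) * q \<le> prob (C k)" for k
  proof -
    have "k = N * (k div N) + k mod N" by simp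
    then have k: "real k = real N * real (k div N) + real (k mod N)"
      by (metis of_nat_add of_nat_mult)
    have mod: "k mod N < N" using N by simp
    then have diff: "n k - real k / real N = real (N - k mod N) / real N"
      using N k by (simp add: n_def field_simps of_nat_diff)
    have lt: "real k / real N < n k"
      using diff mod N by (smt (verit) divide_pos_pos of_nat_0_less_iff zero_less_diff)
    have "prob (C k) = prob (A k) * prob {\<omega> \<in> space M. X (n k - real k / real N) \<omega> \<in> {- z..}}"
      unfolding C_def x_def using lt A_F by (intro prob_past_and_increment) auto
    moreover have "q \<le> prob {\<omega> \<in> space M. X (n k - real k / real N) \<omega> \<in> {- z..}}"
      using q[of "N - k mod N"] mod unfolding diff by simp
    ultimately show ?thesis by (simp add: mult_left_mono)
  qed
  have "(\<lambda>k. prob (A k) * q) sums (prob (\<Union>k. A k) * q)"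
    using A_disj by (intro sums_mult2 finite_measure_UNION) auto
  moreover have "(\<lambda>k. prob (C k)) sums prob (\<Union>k. C k)"
    using C_disj by (intro finite_measure_UNION) auto
  ultimately have "prob (\<Union>k. A k) * q \<le> prob (\<Union>k. C k)"
    by (rule sums_le[OF le])
  also have "\<dots> \<le> prob {\<omega> \<in> space M. \<exists>n::nat. u - z < X (real n) \<omega>}"
  proof (rule finite_measure_mono)
    show "(\<Union>k. C k) \<subseteq> {\<omega> \<in> space M. \<exists>n::nat. u - z < X (real n) \<omega>}"
    proof safe
      fix \<omega> k assume "\<omega> \<in> C k"
      then have "u - z < X (real (k div N + 1)) \<omega>" by (auto simp: C_def A_def n_def)
      then show "\<exists>n::nat. u - z < X (real n) \<omega>" by blast
    qed (auto simp: C_def A_def)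
  qed measurable
  finally show ?thesis unfolding UN_A by (simp add: x_def)
qed

end

lemma dyadic_between:
  fixes t b :: real
  assumes "0 \<le> t" "t < b"
  obtains k m :: nat where "t < real k / 2 ^ m" "real k / 2 ^ m < b"
proof -
  obtain m where m: "(1/2) ^ m < b - t"
    using real_arch_pow_inv[of "b - t" "1/2"] assms by auto
  define k where "k = nat \<lfloor>t * 2 ^ m\<rfloor> + 1"
  have k: "real k = of_int \<lfloor>t * 2 ^ m\<rfloor> + 1"
    using assms by (simp add: k_def)
  have "t * 2 ^ m < real k" unfolding k by linarith
  then have "t < real k / 2 ^ m" by (simp add: field_simps)
  moreover have "real k \<le> t * 2 ^ m + 1" unfolding k by linarith
  then have "real k / 2 ^ m \<le> t + (1/2) ^ m"
    by (simp add: field_simps power_divide)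
  then have "real k / 2 ^ m < b" using m by linarith
  ultimately show ?thesis by (rule that)
qed

context levy
begin

text \<open>A right-continuous path that exceeds \<open>u\<close> does so on an interval. This makes events about all times
  countable, and hence measurable.\<close>

lemma exceeds_iff_exceeds_dyadic:
  assumes \<omega>: "\<omega> \<in> space M"
  shows "(\<exists>t\<ge>0. u < X t \<omega>) \<longleftrightarrow> (\<exists>m k :: nat. u < X (real k / 2 ^ m) \<omega>)"
proof
  assume "\<exists>t\<ge>0. u < X t \<omega>"
  then obtain t where t: "0 \<le> t" "u < X t \<omega>" by blast
  have "\<forall>\<^sub>F s in at_right t. u < X s \<omega>"
    using path_right_continuous[OF \<omega> t(1)] t(2) by (rule order_tendstoD(1))
  then obtain b where b: "t < b" "\<And>s. t < s \<Longrightarrow> s < b \<Longrightarrow> u < X s \<omega>"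
    unfolding eventually_at_right_field by blast
  obtain k m :: nat where "t < real k / 2 ^ m" "real k / 2 ^ m < b"
    using dyadic_between[OF t(1) b(1)] by blast
  then show "\<exists>m k :: nat. u < X (real k / 2 ^ m) \<omega>" using b(2) by blast
next
  assume "\<exists>m k :: nat. u < X (real k / 2 ^ m) \<omega>"
  then obtain m k :: nat where "u < X (real k / 2 ^ m) \<omega>" by blast
  moreover have "0 \<le> real k / 2 ^ m" by simp
  ultimately show "\<exists>t\<ge>0. u < X t \<omega>" by blast
qed

lemma exceeds_measurable [measurable]:
  "{\<omega> \<in> space M. \<exists>t\<ge>0. u < X t \<omega>} \<in> events"
proof -
  have [measurable]: "X (real k / 2 ^ m) \<in> borel_measurable M" for k m :: nat
    by (rule process_measurable) simp
  have "{\<omega> \<in> space M. \<exists>t\<ge>0. u < X t \<omega>} = {\<omega> \<in> space M. \<exists>m k :: nat. u < X (real k / 2 ^ m) \<omega>}"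
    using exceeds_iff_exceeds_dyadic by (intro Collect_cong conj_cong) auto
  also have "\<dots> \<in> events" by measurable
  finally show ?thesis .
qed

text \<open>Dyadic grids are nested, so the probabilities of exceeding \<open>u\<close> on the grid of mesh \<open>1 / 2 ^ m\<close> increase
  to that of exceeding it at any time, while \<open>q\<close> is the same for every mesh.\<close>

lemma first_passage:
  assumes q: "\<And>N j :: nat. 1 \<le> j \<Longrightarrow> j \<le> N \<Longrightarrow> q \<le> prob {\<omega> \<in> space M. - z \<le> X (real j / real N) \<omega>}"
  shows "prob {\<omega> \<in> space M. \<exists>t\<ge>0. u < X t \<omega>} * q \<le> prob {\<omega> \<in> space M. \<exists>n::nat. u - z < X (real n) \<omega>}"
proof (rule LIMSEQ_le_const2)
  define E where "E m = {\<omega> \<in> space M. \<exists>k::nat. u < X (real k / 2 ^ m) \<omega>}" for m :: nat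
  have [measurable]: "X (real k / 2 ^ m) \<in> borel_measurable M" for k m :: nat
    by (rule process_measurable) simp
  have E_meas: "E m \<in> events" for m unfolding E_def by measurable
  have "incseq E"
  proof (rule incseq_SucI)
    fix m
    have "real k / 2 ^ m = real (2 * k) / 2 ^ Suc m" for k by simp
    then show "E m \<subseteq> E (Suc m)" unfolding E_def by (auto intro: exI[of _ "2 * k" for k])
  qed
  then have "(\<lambda>m. prob (E m)) \<longlonglongrightarrow> prob (\<Union>m. E m)"
    using E_meas by (intro finite_Lim_measure_incseq) auto
  also have "(\<Union>m. E m) = {\<omega> \<in> space M. \<exists>t\<ge>0. u < X t \<omega>}"
    unfolding E_def using exceeds_iff_exceeds_dyadic by blast
  finally show "(\<lambda>m. prob (E m) * q) \<longlonglongrightarrow> prob {\<omega> \<in> space M. \<exists>t\<ge>0. u < X t \<omega>} * q"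
    by (rule tendsto_mult_right)
  have "prob (E m) * q \<le> prob {\<omega> \<in> space M. \<exists>n::nat. u - z < X (real n) \<omega>}" for m
    using first_passage_on_grid[of "2 ^ m" q z u, OF _ q] by (simp add: E_def)
  then show "\<exists>m. \<forall>n\<ge>m. prob (E n) * q \<le> prob {\<omega> \<in> space M. \<exists>n::nat. u - z < X (real n) \<omega>}"
    by blast
qed

lemma first_passage_small_steps:
  assumes z: "0 < z" and \<eta>: "\<eta> = prob {\<omega> \<in> space M. z / 10 < \<bar>X 1 \<omega>\<bar>}" "3 * \<eta> < 1"
  shows "prob {\<omega> \<in> space M. \<exists>t\<ge>0. u < X t \<omega>} * (1 - \<eta>) \<le>
    prob {\<omega> \<in> space M. \<exists>n::nat. u - z < X (real n) \<omega>}"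
proof (rule first_passage)
  fix N j :: nat assume j: "1 \<le> j" "j \<le> N"
  have [measurable]: "X (real j / real N) \<in> borel_measurable M"
    by (rule process_measurable) simp
  have "prob {\<omega> \<in> space M. 10 * (z / 10) < \<bar>X (real j / real N) \<omega>\<bar>} \<le> \<eta>"
    by (rule grid_values_small[OF j \<eta>]) (use z in simp)
  then have "1 - \<eta> \<le> 1 - prob {\<omega> \<in> space M. z < \<bar>X (real j / real N) \<omega>\<bar>}" by simp
  also have "\<dots> = prob {\<omega> \<in> space M. \<not> z < \<bar>X (real j / real N) \<omega>\<bar>}"
    by (rule prob_neg[symmetric]) measurable
  also have "\<dots> \<le> prob {\<omega> \<in> space M. - z \<le> X (real j / real N) \<omega>}"
    by (rule finite_measure_mono) (auto, measurable)
  finally show "1 - \<eta> \<le> prob {\<omega> \<in> space M. - z \<le> X (real j / real N) \<omega>}" .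
qed

lemma bounded_iff_not_exceeds:
  "{\<omega> \<in> space M. \<forall>t\<ge>0. X t \<omega> \<le> x} = space M - {\<omega> \<in> space M. \<exists>t\<ge>0. x < X t \<omega>}"
  by (auto simp: not_less)

lemma bounded_measurable [measurable]: "{\<omega> \<in> space M. \<forall>t\<ge>0. X t \<omega> \<le> x} \<in> events"
  unfolding bounded_iff_not_exceeds by measurable

text \<open>If \<open>\<eta>\<close>, the probability that \<open>X 1\<close> exceeds \<open>z / 10\<close> in absolute value, is at least \<open>1/3\<close>, then the right
  side is at least 1. Otherwise \<open>\<eta>\<close> is an upper bound for the error in the first passage inequality,
  so the factor 3 merely merges the two cases.\<close>

lemma skeleton_vs_process_bounded:
  assumes z: "0 < z"
  shows "prob {\<omega> \<in> space M. \<forall>n::nat. X (real n) \<omega> \<le> x} \<le>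
    prob {\<omega> \<in> space M. \<forall>t\<ge>0. X t \<omega> \<le> x + z} + 3 * prob {\<omega> \<in> space M. z / 10 < \<bar>X 1 \<omega>\<bar>}"
proof -
  define \<eta> where "\<eta> = prob {\<omega> \<in> space M. z / 10 < \<bar>X 1 \<omega>\<bar>}"
  define p where "p = prob {\<omega> \<in> space M. \<exists>t\<ge>0. x + z < X t \<omega>}"
  have [measurable]: "X (real n) \<in> borel_measurable M" for n
    by (rule process_measurable) simp
  have G: "prob {\<omega> \<in> space M. \<forall>n::nat. X (real n) \<omega> \<le> x} = 1 - prob {\<omega> \<in> space M. \<exists>n::nat. x < X (real n) \<omega>}"
    using prob_neg[of "\<lambda>\<omega>. \<exists>n::nat. x < X (real n) \<omega>"] by (simp add: not_less)
  have H: "prob {\<omega> \<in> space M. \<forall>t\<ge>0. X t \<omega> \<le> x + z} = 1 - p"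
    unfolding bounded_iff_not_exceeds p_def by (rule prob_compl) measurable
  have p: "0 \<le> p" "p \<le> 1" by (simp_all add: p_def)
  have \<eta>: "0 \<le> \<eta>" by (simp add: \<eta>_def)
  show ?thesis
  proof (cases "3 * \<eta> < 1")
    case True
    have "p * (1 - \<eta>) \<le> prob {\<omega> \<in> space M. \<exists>n::nat. x < X (real n) \<omega>}"
      using first_passage_small_steps[OF z \<eta>_def True, of "x + z"] by (simp add: p_def)
    moreover have "p * \<eta> \<le> 1 * \<eta>" using p \<eta> by (intro mult_right_mono) auto
    ultimately show ?thesis
      using \<eta> unfolding G H \<eta>_def[symmetric] by (simp add: right_diff_distrib)
  next
    case False
    have "prob {\<omega> \<in> space M. \<forall>n::nat. X (real n) \<omega> \<le> x} \<le> 1" by simp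
    then show ?thesis using False p unfolding H \<eta>_def[symmetric] by linarith
  qed
qed

lemma process_vs_skeleton_bounded:
  assumes "x \<le> y"
  shows "prob {\<omega> \<in> space M. \<forall>t\<ge>0. X t \<omega> \<le> x} \<le> prob {\<omega> \<in> space M. \<forall>n::nat. X (real n) \<omega> \<le> y}"
proof (rule finite_measure_mono)
  have [measurable]: "X (real n) \<in> borel_measurable M" for n
    by (rule process_measurable) simp
  show "{\<omega> \<in> space M. \<forall>n::nat. X (real n) \<omega> \<le> y} \<in> events" by measurable
  show "{\<omega> \<in> space M. \<forall>t\<ge>0. X t \<omega> \<le> x} \<subseteq> {\<omega> \<in> space M. \<forall>n::nat. X (real n) \<omega> \<le> y}"
    using assms order_trans[OF _ assms] by auto
qed

text \<open>Fix a loss \<open>k\<close> so large that the first passage inequality holds with a factor of at least \<open>1/2\<close>. Then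
  the probability that the process exceeds \<open>j\<close> is at most twice the probability that the skeleton
  exceeds \<open>j - k\<close>, and this tends to 0 as \<open>j\<close> grows.\<close>

lemma AE_process_bounded:
  assumes skel: "AE \<omega> in M. \<exists>u. \<forall>n::nat. X (real n) \<omega> \<le> u"
  shows "AE \<omega> in M. \<exists>u. \<forall>t\<ge>0. X t \<omega> \<le> u"
proof -
  have [measurable]: "X (real n) \<in> borel_measurable M" for n
    by (rule process_measurable) simp
  have [measurable]: "X 1 \<in> borel_measurable M" by (rule process_measurable) simp
  have "(\<lambda>k. prob {\<omega> \<in> space M. real k / 10 < \<bar>X 1 \<omega>\<bar>}) \<longlonglongrightarrow> 0"
  proof -
    define A where "A k = {\<omega> \<in> space M. real k / 10 < \<bar>X 1 \<omega>\<bar>}" for k :: nat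
    have "(\<lambda>k. prob (A k)) \<longlonglongrightarrow> prob (\<Inter>k. A k)"
    proof (rule finite_Lim_measure_decseq)
      show "range A \<subseteq> events" unfolding A_def by auto
      show "decseq A" unfolding A_def decseq_def by (auto intro: le_less_trans divide_right_mono)
    qed
    also have "(\<Inter>k. A k) = {}"
    proof -
      have "\<omega> \<notin> (\<Inter>k. A k)" for \<omega>
      proof -
        obtain k :: nat where "10 * \<bar>X 1 \<omega>\<bar> \<le> real k" using real_arch_simple by blast
        then have "\<omega> \<notin> A k" by (simp add: A_def)
        then show ?thesis by blast
      qed
      then show ?thesis by blast
    qed
    finally show ?thesis by (simp add: A_def)
  qed
  then have "\<forall>\<^sub>F k in sequentially. prob {\<omega> \<in> space M. real k / 10 < \<bar>X 1 \<omega>\<bar>} < 1/4"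
    by (rule order_tendstoD) simp
  then have "\<forall>\<^sub>F k in sequentially. prob {\<omega> \<in> space M. real k / 10 < \<bar>X 1 \<omega>\<bar>} < 1/4 \<and> 0 < k"
    by (intro eventually_conj eventually_gt_at_top)
  then obtain k :: nat where k: "prob {\<omega> \<in> space M. real k / 10 < \<bar>X 1 \<omega>\<bar>} < 1/4" "0 < k"
    using eventually_happens'[OF sequentially_bot] by blast
  define \<eta> where "\<eta> = prob {\<omega> \<in> space M. real k / 10 < \<bar>X 1 \<omega>\<bar>}"
  define E where "E j = {\<omega> \<in> space M. \<exists>n::nat. real j - real k < X (real n) \<omega>}" for j :: nat
  define B where "B = {\<omega> \<in> space M. \<forall>j::nat. \<exists>t\<ge>0. real j < X t \<omega>}"
  have E_meas: "E j \<in> events" for j unfolding E_def by measurable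
  have B_le: "prob B \<le> 2 * prob (E j)" for j
  proof -
    define P where "P = prob {\<omega> \<in> space M. \<exists>t\<ge>0. real j < X t \<omega>}"
    have "P * (1 - \<eta>) \<le> prob (E j)"
      unfolding E_def P_def using k by (intro first_passage_small_steps \<eta>_def) (simp_all add: \<eta>_def)
    moreover have "P * (1/2) \<le> P * (1 - \<eta>)"
      using k by (intro mult_left_mono) (simp_all add: P_def \<eta>_def)
    moreover have "prob B \<le> P"
      unfolding B_def P_def by (rule finite_measure_mono) auto
    ultimately show ?thesis by linarith
  qed
  have "(\<lambda>j. 2 * prob (E j)) \<longlonglongrightarrow> 2 * 0"
  proof (rule tendsto_mult_left)
    have "(\<lambda>j. prob (E j)) \<longlonglongrightarrow> prob (\<Inter>j. E j)"
    proof (rule finite_Lim_measure_decseq)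
      show "range E \<subseteq> events" using E_meas by auto
      show "decseq E"
      proof (rule decseq_SucI)
        fix j
        show "E (Suc j) \<subseteq> E j"
        proof
          fix \<omega> assume "\<omega> \<in> E (Suc j)"
          then obtain n :: nat where "\<omega> \<in> space M" "real (Suc j) - real k < X (real n) \<omega>"
            unfolding E_def by blast
          moreover from this have "real j - real k < X (real n) \<omega>" by simp
          ultimately show "\<omega> \<in> E j" unfolding E_def by blast
        qed
      qed
    qed
    also have "prob (\<Inter>j. E j) = 0"
    proof (subst prob_eq_0)
      show "(\<Inter>j. E j) \<in> events" using E_meas by auto
      show "AE \<omega> in M. \<omega> \<notin> (\<Inter>j. E j)"
        using skel
      proof (rule AE_mp, intro AE_I2 impI)
        fix \<omega> assume "\<exists>u. \<forall>n::nat. X (real n) \<omega> \<le> u"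
        then obtain u where u: "\<And>n::nat. X (real n) \<omega> \<le> u" by blast
        obtain j :: nat where "u + real k \<le> real j" using real_arch_simple by blast
        have "X (real n) \<omega> \<le> real j - real k" for n :: nat
          using u[of n] \<open>u + real k \<le> real j\<close> by linarith
        then have "\<omega> \<notin> E j" by (auto simp: E_def not_less)
        then show "\<omega> \<notin> (\<Inter>j. E j)" by blast
      qed
    qed
    finally show "(\<lambda>j. prob (E j)) \<longlonglongrightarrow> 0" .
  qed
  then have "prob B \<le> 2 * 0"
    by (rule LIMSEQ_le_const) (use B_le in blast)
  then have "prob B = 0" by (simp add: measure_le_0_iff)
  moreover have "B \<in> events" unfolding B_def by measurable
  ultimately have "AE \<omega> in M. \<omega> \<notin> B" by (simp add: prob_eq_0)
  then show ?thesis
  proof (rule AE_mp, intro AE_I2 impI)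
    fix \<omega> assume "\<omega> \<in> space M" "\<omega> \<notin> B"
    then obtain j :: nat where "\<not> (\<exists>t\<ge>0. real j < X t \<omega>)" unfolding B_def by blast
    then show "\<exists>u. \<forall>t\<ge>0. X t \<omega> \<le> u" by (meson not_less)
  qed
qed

end

text \<open>On the null set of unbounded paths the real supremum takes one fixed value. Hence it is a genuine random
  variable on the whole space, as the pushforward measure requires.\<close>

lemma (in prob_space) cdf_scaled_all_time_sup:
  fixes Z :: "'t \<Rightarrow> 'a \<Rightarrow> real"
  assumes T: "T \<noteq> {}"
    and meas: "\<And>x. {\<omega> \<in> space M. \<forall>t\<in>T. Z t \<omega> \<le> x} \<in> events"
    and bounded: "AE \<omega> in M. \<exists>u. \<forall>t\<in>T. Z t \<omega> \<le> u"
    and c: "0 < c"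
  shows "cdf (distr M borel (\<lambda>\<omega>. c * all_time_sup T Z \<omega>)) x = prob {\<omega> \<in> space M. \<forall>t\<in>T. Z t \<omega> \<le> x / c}"
proof -
  define E where "E x = {\<omega> \<in> space M. \<forall>t\<in>T. Z t \<omega> \<le> x}" for x
  define U where "U = space M - (\<Union>n::nat. E (real n))"
  define c0 :: real where "c0 = (LEAST z. False)"
  have E_meas: "E x \<in> events" for x unfolding E_def by (rule meas)
  then have U_meas: "U \<in> events" unfolding U_def by auto
  have U_iff: "\<omega> \<in> U \<longleftrightarrow> \<omega> \<in> space M \<and> \<not> bdd_above ((\<lambda>t. Z t \<omega>) ` T)" for \<omega>
  proof -
    have "bdd_above ((\<lambda>t. Z t \<omega>) ` T) \<longleftrightarrow> (\<exists>n::nat. \<forall>t\<in>T. Z t \<omega> \<le> real n)"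
    proof
      assume "bdd_above ((\<lambda>t. Z t \<omega>) ` T)"
      then obtain u where u: "\<And>t. t \<in> T \<Longrightarrow> Z t \<omega> \<le> u" unfolding bdd_above_def by auto
      obtain n :: nat where "u \<le> real n" using real_arch_simple by blast
      then have "\<forall>t\<in>T. Z t \<omega> \<le> real n" using u by fastforce
      then show "\<exists>n::nat. \<forall>t\<in>T. Z t \<omega> \<le> real n" by blast
    qed (auto simp: bdd_above_def)
    then show ?thesis unfolding U_def E_def by auto
  qed
  have sup_le: "all_time_sup T Z \<omega> \<le> x \<longleftrightarrow> \<omega> \<in> E x" if "\<omega> \<in> space M" "\<omega> \<notin> U" for \<omega> x
    using that T unfolding U_iff all_time_sup_def E_def by (simp add: cSUP_le_iff)
  have sup_U: "all_time_sup T Z \<omega> = c0" if "\<omega> \<in> U" for \<omega>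
  proof -
    have "(\<forall>x\<in>(\<lambda>t. Z t \<omega>) ` T. x \<le> z) = False" for z
      using that unfolding U_iff bdd_above_def by blast
    then show ?thesis
      unfolding all_time_sup_def Sup_real_def c0_def by (simp only:)
  qed
  have E_U: "\<omega> \<notin> U" if "\<omega> \<in> E x" for \<omega> x
    using that unfolding U_iff bdd_above_def E_def by auto
  have level: "{\<omega> \<in> space M. all_time_sup T Z \<omega> \<le> x} = E x \<union> (if c0 \<le> x then U else {})" for x
    using sup_le sup_U E_U sets.sets_into_space[OF U_meas] sets.sets_into_space[OF E_meas[of x]]
    by (auto; blast)
  have sup_meas [measurable]: "all_time_sup T Z \<in> borel_measurable M"
    by (rule borel_measurableI_le) (use level E_meas U_meas in auto)
  have "cdf (distr M borel (\<lambda>\<omega>. c * all_time_sup T Z \<omega>)) x = prob {\<omega> \<in> space M. c * all_time_sup T Z \<omega> \<le> x}"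
    by (simp add: cdf_def measure_distr vimage_def Int_def conj_commute)
  also have "\<dots> = prob {\<omega> \<in> space M. all_time_sup T Z \<omega> \<le> x / c}"
    using c by (simp add: field_simps)
  also have "\<dots> = prob (E (x / c))"
  proof (rule finite_measure_eq_AE)
    show "AE \<omega> in M. (\<omega> \<in> {\<omega> \<in> space M. all_time_sup T Z \<omega> \<le> x / c}) = (\<omega> \<in> E (x / c))"
      using bounded
    proof (rule AE_mp, intro AE_I2 impI)
      fix \<omega> assume "\<omega> \<in> space M" "\<exists>u. \<forall>t\<in>T. Z t \<omega> \<le> u"
      then have "\<omega> \<notin> U" unfolding U_iff bdd_above_def by auto
      then show "(\<omega> \<in> {\<omega> \<in> space M. all_time_sup T Z \<omega> \<le> x / c}) = (\<omega> \<in> E (x / c))"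
        using sup_le \<open>\<omega> \<in> space M\<close> by auto
    qed
  qed (use E_meas in auto)
  finally show ?thesis by (simp add: E_def)
qed

section \<open>Weak limits of interleaved families\<close>

lemma continuity_point_between:
  fixes r :: "real \<Rightarrow> real"
  assumes "mono r" "a < b"
  obtains y where "a < y" "y < b" "isCont r y"
proof -
  have "{a<..<b} \<inter> {y. \<not> isCont r y} \<noteq> {a<..<b}"
    using countable_subset[OF Int_lower2 mono_ctble_discont[OF assms(1)], of "{a<..<b}"]
      uncountable_open_interval[of a b] assms(2) by auto
  then show ?thesis using that by auto
qed

text \<open>The interleaving says that the Levy distance of \<open>G a\<close> and \<open>H a\<close> tends to 0, which transfers weak limits. A
  continuity point of \<open>r\<close> can be approached from both sides by continuity points, since a monotone
  function has only countably many discontinuities; comparing \<open>H\<close> at the point with \<open>G\<close> at such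
  neighbours gives both bounds.\<close>

lemma interleaved_convergence:
  fixes G H :: "'i \<Rightarrow> real \<Rightarrow> real" and r :: "real \<Rightarrow> real" and e :: "real \<Rightarrow> 'i \<Rightarrow> real"
  assumes r: "mono r"
    and conv: "\<And>x. isCont r x \<Longrightarrow> ((\<lambda>a. G a x) \<longlongrightarrow> r x) \<F>"
    and e: "\<And>z. 0 < z \<Longrightarrow> (e z \<longlongrightarrow> 0) \<F>"
    and GH: "\<And>z x. 0 < z \<Longrightarrow> \<forall>\<^sub>F a in \<F>. G a x \<le> H a (x + z) + e z a"
    and HG: "\<And>z x. 0 < z \<Longrightarrow> \<forall>\<^sub>F a in \<F>. H a x \<le> G a (x + z) + e z a"
    and x: "isCont r x"
  shows "((\<lambda>a. H a x) \<longlongrightarrow> r x) \<F>"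
proof (rule order_tendstoI)
  fix l assume "l < r x"
  then have "\<forall>\<^sub>F y in at_left x. l < r y"
    using x order_tendstoD(1)[of r "r x" "at_left x" l]
    by (simp add: isCont_def filterlim_at_split)
  then obtain b where b: "b < x" "\<And>y. b < y \<Longrightarrow> y < x \<Longrightarrow> l < r y"
    unfolding eventually_at_left_field by blast
  obtain y where y: "b < y" "y < x" "isCont r y"
    using continuity_point_between[OF r b(1)] by blast
  define z where "z = x - y"
  have z: "0 < z" "y + z = x" using y by (auto simp: z_def)
  have "((\<lambda>a. G a y - e z a) \<longlongrightarrow> r y - 0) \<F>"
    by (intro tendsto_diff conv y e z)
  then have "\<forall>\<^sub>F a in \<F>. l < G a y - e z a"
    by (rule order_tendstoD(1)) (use b y in simp)
  with GH[OF z(1), of y] show "\<forall>\<^sub>F a in \<F>. l < H a x"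
    by eventually_elim (use z(2) in auto)
next
  fix l assume "r x < l"
  then have "\<forall>\<^sub>F y in at_right x. r y < l"
    using x order_tendstoD(2)[of r "r x" "at_right x" l]
    by (simp add: isCont_def filterlim_at_split)
  then obtain b where b: "x < b" "\<And>y. x < y \<Longrightarrow> y < b \<Longrightarrow> r y < l"
    unfolding eventually_at_right_field by blast
  obtain y where y: "x < y" "y < b" "isCont r y"
    using continuity_point_between[OF r b(1)] by blast
  define z where "z = y - x"
  have z: "0 < z" "x + z = y" using y by (auto simp: z_def)
  have "((\<lambda>a. G a y + e z a) \<longlongrightarrow> r y + 0) \<F>"
    by (intro tendsto_add conv y e z)
  then have "\<forall>\<^sub>F a in \<F>. G a y + e z a < l"
    by (rule order_tendstoD(2)) (use b y in simp)
  with HG[OF z(1), of x] show "\<forall>\<^sub>F a in \<F>. H a x < l"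
    by eventually_elim (use z(2) in auto)
qed

text \<open>The index is continuous, whereas dominated convergence is a statement about sequences;
  limits at the right of 0 are determined by sequences.\<close>

lemma (in prob_space) AE_tendsto_0_imp_in_probability:
  fixes W :: "real \<Rightarrow> 'a \<Rightarrow> real"
  assumes meas: "\<And>a. 0 < a \<Longrightarrow> W a \<in> borel_measurable M"
    and lim: "AE \<omega> in M. ((\<lambda>a. W a \<omega>) \<longlongrightarrow> 0) (at_right 0)"
    and z: "0 < z"
  shows "((\<lambda>a. prob {\<omega> \<in> space M. z < \<bar>W a \<omega>\<bar>}) \<longlongrightarrow> 0) (at_right 0)"
  unfolding tendsto_at_iff_sequentially
proof (intro allI impI)
  fix s :: "nat \<Rightarrow> real" assume s: "\<forall>i. s i \<in> {0<..} - {0}" "s \<longlonglongrightarrow> 0"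
  define E where "E n = {\<omega> \<in> space M. z < \<bar>W (s n) \<omega>\<bar>}" for n
  have E_meas: "E n \<in> events" for n
  proof -
    have [measurable]: "W (s n) \<in> borel_measurable M" using s by (intro meas) auto
    show ?thesis unfolding E_def by measurable
  qed
  have "(\<lambda>n. LINT \<omega>|M. indicator (E n) \<omega> :: real) \<longlonglongrightarrow> (LINT \<omega>|M. 0)"
  proof (rule integral_dominated_convergence[where w = "\<lambda>_. 1"])
    show "AE \<omega> in M. (\<lambda>n. indicator (E n) \<omega> :: real) \<longlonglongrightarrow> 0"
      using lim
    proof (rule AE_mp, intro AE_I2 impI)
      fix \<omega> assume \<omega>: "((\<lambda>a. W a \<omega>) \<longlongrightarrow> 0) (at_right 0)"
      have "(\<lambda>n. W (s n) \<omega>) \<longlonglongrightarrow> 0"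
        using \<omega>[unfolded tendsto_at_iff_sequentially, rule_format, OF _ s(2)] s(1)
        by (simp add: comp_def)
      then have "\<forall>\<^sub>F n in sequentially. \<bar>W (s n) \<omega>\<bar> < z"
        using z by (auto dest: tendstoD simp: dist_real_def)
      then have "\<forall>\<^sub>F n in sequentially. indicator (E n) \<omega> = (0::real)"
        by eventually_elim (simp add: E_def indicator_def)
      then show "(\<lambda>n. indicator (E n) \<omega> :: real) \<longlonglongrightarrow> 0"
        by (rule tendsto_eventually)
    qed
  qed (use E_meas in auto)
  then show "((\<lambda>a. prob {\<omega> \<in> space M. z < \<bar>W a \<omega>\<bar>}) \<circ> s) \<longlonglongrightarrow> 0"
    using E_meas by (simp add: comp_def E_def)
qed

lemma (in prob_space) partial_sums_bounded_law:
  fixes \<xi> :: "nat \<Rightarrow> 'a \<Rightarrow> real"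
  assumes meas: "\<And>i. \<xi> i \<in> borel_measurable M"
    and law: "distr M (\<Pi>\<^sub>M i\<in>UNIV. borel) (\<lambda>\<omega> i. \<xi> i \<omega>) = (\<Pi>\<^sub>M i\<in>UNIV. \<nu>)"
  shows "prob {\<omega> \<in> space M. \<forall>n. (\<Sum>i<n. \<xi> i \<omega>) \<le> x} =
      measure (\<Pi>\<^sub>M i\<in>UNIV. \<nu>) {y \<in> space (\<Pi>\<^sub>M i\<in>(UNIV::nat set). borel). \<forall>n. (\<Sum>i<n. y i) \<le> x}"
    and "(AE y in \<Pi>\<^sub>M i\<in>(UNIV::nat set). \<nu>. \<exists>u. \<forall>n. (\<Sum>i<n. y i) \<le> u) \<Longrightarrow>
      AE \<omega> in M. \<exists>u. \<forall>n. (\<Sum>i<n. \<xi> i \<omega>) \<le> u"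
proof -
  have seq: "(\<lambda>\<omega> i. \<xi> i \<omega>) \<in> measurable M (\<Pi>\<^sub>M i\<in>UNIV. borel)"
    by (rule measurable_PiM_single') (auto simp: space_PiM meas)
  show "prob {\<omega> \<in> space M. \<forall>n. (\<Sum>i<n. \<xi> i \<omega>) \<le> x} =
      measure (\<Pi>\<^sub>M i\<in>UNIV. \<nu>) {y \<in> space (\<Pi>\<^sub>M i\<in>(UNIV::nat set). borel). \<forall>n. (\<Sum>i<n. y i) \<le> x}"
    unfolding law[symmetric]
    by (subst measure_distr[OF seq]) (measurable, auto simp: space_PiM intro!: arg_cong[where f = prob])
  assume "AE y in \<Pi>\<^sub>M i\<in>(UNIV::nat set). \<nu>. \<exists>u. \<forall>n. (\<Sum>i<n. y i) \<le> u"
  then show "AE \<omega> in M. \<exists>u. \<forall>n. (\<Sum>i<n. \<xi> i \<omega>) \<le> u"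
    unfolding law[symmetric] by (rule AE_distrD[OF seq])
qed

theorem theorem1:
  fixes M :: "'a measure"
    and F :: "real \<Rightarrow> 'a measure"
    and Y S :: "real \<Rightarrow> nat \<Rightarrow> 'a \<Rightarrow> real"
    and X :: "real \<Rightarrow> real \<Rightarrow> 'a \<Rightarrow> real"
    and \<mu> \<Delta> :: "real \<Rightarrow> real"
    and R :: "'a \<Rightarrow> real"
  assumes "prob_space M"
    and "standard_filtration M F"
    and "\<And>a. a > 0 \<Longrightarrow> prob_space.indep_vars M (\<lambda>_. borel) (Y a) {1..}"
    and "\<And>a n. a > 0 \<Longrightarrow> n \<ge> 1 \<Longrightarrow> distr M borel (Y a n) = distr M borel (Y a 1)"
    and "\<And>a n \<omega>. S a n \<omega> = (\<Sum>k=1..n. Y a k \<omega>)"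
    and "\<And>a. a > 0 \<Longrightarrow> levy_process M F (X a)"
    and "\<And>a. a > 0 \<Longrightarrow> nondeterministic M (X a)"
    and "\<And>a. a > 0 \<Longrightarrow> distr M borel (Y a 1) = distr M borel (X a 1)"
    and "\<And>a. a > 0 \<Longrightarrow> integrable M (Y a 1)"
    and "\<And>a. \<mu> a = prob_space.expectation M (Y a 1)"
    and "\<And>a. a > 0 \<Longrightarrow> \<mu> a < 0"
    and "\<And>a b. 0 < a \<Longrightarrow> a \<le> b \<Longrightarrow> \<mu> b \<le> \<mu> a"
    and "(\<mu> \<longlongrightarrow> 0) (at_right 0)"
    and "\<And>a. a > 0 \<Longrightarrow> \<Delta> a > 0"
    and "AE \<omega> in M. ((\<lambda>a. \<Delta> a * X a 1 \<omega>) \<longlongrightarrow> 0) (at_right 0)"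
    and "R \<in> borel_measurable M"
  shows "converges_in_distribution M (\<lambda>a \<omega>. \<Delta> a * all_time_sup UNIV (S a) \<omega>) R (at_right 0) \<longleftrightarrow>
         converges_in_distribution M (\<lambda>a \<omega>. \<Delta> a * all_time_sup {0..} (X a) \<omega>) R (at_right 0)"
proof -
  interpret prob_space M by fact
  define r where "r = cdf (distr M borel R)"
  define G where "G a x = cdf (distr M borel (\<lambda>\<omega>. \<Delta> a * all_time_sup UNIV (S a) \<omega>)) x" for a x
  define H where "H a x = cdf (distr M borel (\<lambda>\<omega>. \<Delta> a * all_time_sup {0..} (X a) \<omega>)) x" for a x
  define e where "e z a = 3 * prob {\<omega> \<in> space M. z / 10 < \<bar>\<Delta> a * X a 1 \<omega>\<bar>}" for z a
  have lev: "levy M F (X a)" if "0 < a" for a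
    using assms(1,2,6) that by (simp add: levy_def levy_axioms_def)
  have "real_distribution (distr M borel R)"
    using assms(16) by (rule real_distribution_distr)
  then interpret R: real_distribution "distr M borel R" .
  have r: "mono r" unfolding r_def by (intro monoI R.cdf_nondecreasing)

  \<comment> \<open>The comparison of process and skeleton at level \<open>x / \<Delta> a\<close> and loss \<open>z / \<Delta> a\<close>, rescaled.\<close>
  have sandwich: "G a x \<le> H a (x + z) + e z a \<and> H a x \<le> G a (x + z)" if a: "0 < a" and z: "0 < z" for a x z
  proof -
    interpret X: levy M F "X a" by (rule lev[OF a])
    let ?\<nu> = "distr M borel (X a 1)"
    have \<Delta>: "0 < \<Delta> a" using assms(14) a .
    have Y_meas: "Y a n \<in> borel_measurable M" if "1 \<le> n" for n
      using assms(3)[OF a] that by (auto simp: indep_vars_def)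
    have X1: "X a 1 \<in> borel_measurable M" by (rule X.process_measurable) simp
    have Y_law: "distr M (\<Pi>\<^sub>M i\<in>UNIV. borel) (\<lambda>\<omega> i. Y a (Suc i) \<omega>) = (\<Pi>\<^sub>M i\<in>UNIV. ?\<nu>)"
      by (rule iid_sequence_law[OF assms(3)[OF a] trans[OF assms(4)[OF a] assms(8)[OF a]]])
    have S_sum: "S a n \<omega> = (\<Sum>i<n. Y a (Suc i) \<omega>)" for n \<omega>
      unfolding assms(5) by (rule sum.reindex_bij_witness[of _ Suc "\<lambda>k. k - 1"]) auto
    have X_sum: "X a (real n) \<omega> = (\<Sum>i<n. X a (real i + 1) \<omega> - X a (real i) \<omega>)" if "\<omega> \<in> space M" for n \<omega>
      using X.process_0[OF that] by (induction n) (simp_all add: add.commute)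
    have inc_meas: "(\<lambda>\<omega>. X a (real i + 1) \<omega> - X a (real i) \<omega>) \<in> borel_measurable M" for i
      by (intro borel_measurable_diff X.process_measurable) simp_all
    have mean: "integrable ?\<nu> (\<lambda>y. y)" "(LINT y|?\<nu>. y) < 0"
      using assms(9,11)[OF a] Y_meas[of 1]
      unfolding assms(8)[OF a, symmetric] assms(10) by (simp_all add: integrable_distr_eq integral_distr)
    have walk_bounded: "AE y in \<Pi>\<^sub>M i\<in>(UNIV::nat set). ?\<nu>. \<exists>u. \<forall>n. (\<Sum>i<n. y i) \<le> u"
      by (rule negative_drift_sums_bounded_above[OF prob_space_distr[OF X1] _ mean]) simp
    have S_bounded: "AE \<omega> in M. \<exists>u. \<forall>n\<in>UNIV. S a n \<omega> \<le> u"
      using partial_sums_bounded_law(2)[OF Y_meas Y_law walk_bounded] by (simp add: S_sum)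
    have "AE \<omega> in M. \<exists>u. \<forall>n. (\<Sum>i<n. X a (real i + 1) \<omega> - X a (real i) \<omega>) \<le> u"
      by (rule partial_sums_bounded_law(2)[OF inc_meas X.unit_increments_law walk_bounded])
    then have "AE \<omega> in M. \<exists>u. \<forall>n::nat. X a (real n) \<omega> \<le> u"
      by (rule AE_mp) (simp add: X_sum)
    from X.AE_process_bounded[OF this]
    have X_bounded: "AE \<omega> in M. \<exists>u. \<forall>t\<in>{0..}. X a t \<omega> \<le> u"
      by (simp add: Ball_def)
    have S_meas: "{\<omega> \<in> space M. \<forall>n\<in>UNIV. S a n \<omega> \<le> y} \<in> events" for y
    proof -
      have [measurable]: "S a n \<in> borel_measurable M" for n
        unfolding S_sum[abs_def] by (intro borel_measurable_sum Y_meas) simp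
      show ?thesis by measurable
    qed
    have G: "G a y = prob {\<omega> \<in> space M. \<forall>n::nat. X a (real n) \<omega> \<le> y / \<Delta> a}" for y
    proof -
      have "G a y = prob {\<omega> \<in> space M. \<forall>n. (\<Sum>i<n. Y a (Suc i) \<omega>) \<le> y / \<Delta> a}"
        unfolding G_def by (subst cdf_scaled_all_time_sup[OF _ S_meas S_bounded \<Delta>]) (simp_all add: S_sum)
      also have "\<dots> = prob {\<omega> \<in> space M. \<forall>n. (\<Sum>i<n. X a (real i + 1) \<omega> - X a (real i) \<omega>) \<le> y / \<Delta> a}"
        by (subst (1 2) partial_sums_bounded_law(1)[where \<nu> = ?\<nu>])
          (simp_all add: Y_meas Y_law inc_meas X.unit_increments_law)
      also have "\<dots> = prob {\<omega> \<in> space M. \<forall>n::nat. X a (real n) \<omega> \<le> y / \<Delta> a}"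
        by (intro arg_cong[where f = prob] Collect_cong conj_cong) (simp_all add: X_sum)
      finally show ?thesis .
    qed
    have H: "H a y = prob {\<omega> \<in> space M. \<forall>t\<ge>0. X a t \<omega> \<le> y / \<Delta> a}" for y
      unfolding H_def using X.bounded_measurable
      by (subst cdf_scaled_all_time_sup[OF _ _ X_bounded \<Delta>]) (simp_all add: Ball_def)
    have e: "e z a = 3 * prob {\<omega> \<in> space M. z / \<Delta> a / 10 < \<bar>X a 1 \<omega>\<bar>}"
      unfolding e_def using \<Delta> by (simp add: abs_mult field_simps)
    have "0 < z / \<Delta> a" using z \<Delta> by simp
    from X.skeleton_vs_process_bounded[OF this, of "x / \<Delta> a"] X.process_vs_skeleton_bounded[of "x / \<Delta> a" "(x + z) / \<Delta> a"]
    show ?thesis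
      using z \<Delta> unfolding G H e by (simp add: add_divide_distrib)
  qed

  have e_nonneg: "0 \<le> e z a" for z a by (simp add: e_def)
  have e_lim: "(e z \<longlongrightarrow> 0) (at_right 0)" if "0 < z" for z
  proof -
    have "((\<lambda>a. prob {\<omega> \<in> space M. z / 10 < \<bar>\<Delta> a * X a 1 \<omega>\<bar>}) \<longlongrightarrow> 0) (at_right 0)"
    proof (rule AE_tendsto_0_imp_in_probability[OF _ assms(15)])
      fix a :: real assume "0 < a"
      then interpret X: levy M F "X a" by (rule lev)
      show "(\<lambda>\<omega>. \<Delta> a * X a 1 \<omega>) \<in> borel_measurable M"
        by (intro borel_measurable_times borel_measurable_const X.process_measurable) simp
    qed (use that in simp)
    from tendsto_mult_right_zero[OF this, of 3] show ?thesis unfolding e_def .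
  qed
  have GH: "\<forall>\<^sub>F a in at_right 0. G a x \<le> H a (x + z) + e z a" if "0 < z" for x z
    using eventually_at_right_less[of 0] by eventually_elim (use sandwich that in blast)
  have HG: "\<forall>\<^sub>F a in at_right 0. H a x \<le> G a (x + z) + e z a" if "0 < z" for x z
    using eventually_at_right_less[of 0]
  proof eventually_elim
    case (elim a)
    show ?case
      using sandwich[OF elim that, of x] e_nonneg[of z a] by linarith
  qed
  show ?thesis
    unfolding converges_in_distribution_def r_def[symmetric] G_def[symmetric] H_def[symmetric]
  proof (intro iffI allI impI)
    fix x assume "\<forall>x. isCont r x \<longrightarrow> ((\<lambda>a. G a x) \<longlongrightarrow> r x) (at_right 0)" "isCont r x"
    then show "((\<lambda>a. H a x) \<longlongrightarrow> r x) (at_right 0)"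
      by (intro interleaved_convergence[OF r _ e_lim GH HG]) auto
  next
    fix x assume "\<forall>x. isCont r x \<longrightarrow> ((\<lambda>a. H a x) \<longlongrightarrow> r x) (at_right 0)" "isCont r x"
    then show "((\<lambda>a. G a x) \<longlongrightarrow> r x) (at_right 0)"
      by (intro interleaved_convergence[OF r _ e_lim HG GH]) auto
  qed
qed

end
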